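(* There exist numerical constants $C,C'>0$ such that the following holds. Let $d\ge 2$ and let $\mathcal I$ be the set of all nonempty subsets of $\{1,\dots,d\}$. For any $\mathcal U\subseteq\mathcal I$ such that $|\mathcal U|\ge C'$, any $\rho$ such that $0<\rho\le|\mathcal U|^{-3}(\ln|\mathcal U|)^{-1/2}C^{-1}$ (and $\rho<1$), and any integers $t,s,\ell\ge1$, any $(t,s,\ell)$-algorithm identifying $\mu\in\mathcal P_{\mathcal U,\rho}$ with error $1/3$ satisfies $$ts\ell\ge\frac{|\mathcal U|}{C\,\rho^2\ln|\mathcal U|}.$$
   Context: For $I\in\mathcal I$ and $0<\rho<1$, $\mu_{I,\rho}$ is the distribution on $\{-1,1\}^d$ given by $\mu_{I,\rho}((x_1,\dots,x_d))=2^{-d}\left(1+\rho\prod_{i\in I}x_i\right)$. $\mathcal P_{\mathcal U,\rho}=\{\mu_{I,\rho}\colon I\in\mathcal U\}$. Memory-limited algorithms: a $(t,s,\ell)$-algorithm identifying a distribution in a finite family with error $\varepsilon$ receives $t$ i.i.d. samples from some member $\mu$ of the family and goes over them sequentially in $\ell$ passes using at most $s$ bits of memory: letting $x_1,\dots,x_{t\ell}$ be $\ell$ copies of the data set in order, its memory states $u_j\in\{0,1\}^s$ satisfy $u_{j+1}=f_j(x_j,u_j)$ for arbitrary functions $f_j$, and its output is a function of $u_{t\ell+1}$. For every member $\mu$ of the family, when the data is generated by $\mu$, the algorithm outputs (the index of) $\mu$ with probability at least $1-\varepsilon$. *)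

theory Defs
  imports "HOL-Probability.Probability"
begin

definition cube :: "nat \<Rightarrow> (nat \<Rightarrow> real) set" where
  "cube d = ({1..d} \<rightarrow>\<^sub>E {-1, 1})"

definition mu_density :: "nat \<Rightarrow> nat set \<Rightarrow> real \<Rightarrow> (nat \<Rightarrow> real) \<Rightarrow> real" where
  "mu_density d I \<rho> x = (if x \<in> cube d then (1 + \<rho> * (\<Prod>i\<in>I. x i)) / 2 ^ d else 0)"

(* embed_pmf is only meaningful for a probability mass function; see pmf_mu below. *)
definition mu :: "nat \<Rightarrow> nat set \<Rightarrow> real \<Rightarrow> (nat \<Rightarrow> real) pmf" where
  "mu d I \<rho> = embed_pmf (mu_density d I \<rho>)"

definition mu_family :: "nat \<Rightarrow> nat set set \<Rightarrow> real \<Rightarrow> (nat \<Rightarrow> real) pmf set" where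
  "mu_family d \<U> \<rho> = (\<lambda>I. mu d I \<rho>) ` \<U>"

lemma finite_cube: "finite (cube d)"
  unfolding cube_def by (intro finite_PiE) auto

lemma prod_signs:
  assumes "\<And>i. i \<in> I \<Longrightarrow> x i \<in> {-1, 1 :: real}"
  shows "(\<Prod>i\<in>I. x i) \<in> {-1, 1}"
  using assms by (induction I rule: infinite_finite_induct) fastforce+

lemma sum_cube_prod:
  assumes "I \<subseteq> {1..d}" "I \<noteq> {}"
  shows "(\<Sum>x\<in>cube d. \<Prod>i\<in>I. x i) = 0"
proof -
  have "(\<Sum>x\<in>cube d. \<Prod>i\<in>I. x i) = (\<Sum>x\<in>cube d. \<Prod>i\<in>{1..d}. if i \<in> I then x i else 1)"
    using assms(1) by (intro sum.cong refl) (simp add: prod.If_cases Int_absorb1)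
  also have "\<dots> = (\<Prod>i\<in>{1..d}. \<Sum>y\<in>{-1, 1::real}. if i \<in> I then y else 1)"
    unfolding cube_def by (subst prod_sum_PiE) auto
  also have "\<dots> = 0"
    using assms by (intro prod_zero) auto
  finally show ?thesis .
qed

lemma pmf_mu:
  assumes "I \<subseteq> {1..d}" "I \<noteq> {}" "0 < \<rho>" "\<rho> < 1"
  shows "pmf (mu d I \<rho>) x = mu_density d I \<rho> x"
  unfolding mu_def
proof (rule pmf_embed_pmf)
  show nonneg: "0 \<le> mu_density d I \<rho> x" for x
  proof (cases "x \<in> cube d")
    case True
    then have "\<And>i. i \<in> I \<Longrightarrow> x i \<in> {-1, 1}"
      using assms(1) unfolding cube_def by (meson PiE_mem subsetD)
    from prod_signs[of I x, OF this] show ?thesis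
      using assms by (auto simp: mu_density_def)
  qed (simp add: mu_density_def)
  have "(\<integral>\<^sup>+ x. ennreal (mu_density d I \<rho> x) \<partial>count_space UNIV) =
      (\<Sum>x\<in>cube d. ennreal (mu_density d I \<rho> x))"
    by (intro nn_integral_count_space' finite_cube) (auto simp: mu_density_def)
  also have "\<dots> = ennreal (\<Sum>x\<in>cube d. mu_density d I \<rho> x)"
    by (intro sum_ennreal nonneg)
  also have "(\<Sum>x\<in>cube d. mu_density d I \<rho> x) =
      (\<Sum>x\<in>cube d. 1 + \<rho> * (\<Prod>i\<in>I. x i)) / 2 ^ d"
    by (simp add: mu_density_def sum_divide_distrib)
  also have "\<dots> = real (card (cube d)) / 2 ^ d"
    using sum_cube_prod[OF assms(1,2)]
    by (simp add: sum.distrib sum_distrib_left[symmetric])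
  also have "card (cube d) = 2 ^ d"
    by (simp add: cube_def card_PiE numeral_2_eq_2)
  finally show "(\<integral>\<^sup>+ x. ennreal (mu_density d I \<rho> x) \<partial>count_space UNIV) = 1"
    by simp
qed

(* Members of the family are in bijection with their indices, so outputting the
   distribution is the same as outputting its index. *)
lemma inj_on_mu:
  assumes "0 < \<rho>" "\<rho> < 1"
  shows "inj_on (\<lambda>I. mu d I \<rho>) (Pow {1..d} - {{}})"
proof -
  have False if IJ: "I \<subseteq> {1..d}" "J \<subseteq> {1..d}" "I \<noteq> {}" "J \<noteq> {}"
    and i: "i \<in> I" "i \<notin> J" and eq: "mu d I \<rho> = mu d J \<rho>" for I J i
  proof -
    define x where "x = (\<lambda>j\<in>{1..d}. if j = i then -1 else (1::real))"
    have x: "x \<in> cube d"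
      by (auto simp: x_def cube_def)
    have "(\<Prod>j\<in>J. x j) = 1"
      using IJ i by (intro prod.neutral) (auto simp: x_def)
    moreover have fin: "finite I"
      using IJ finite_subset by blast
    have "(\<Prod>j\<in>I. x j) = x i * (\<Prod>j\<in>I - {i}. x j)"
      using fin i by (simp add: prod.remove)
    moreover have "(\<Prod>j\<in>I - {i}. x j) = 1"
      using IJ i by (intro prod.neutral) (auto simp: x_def)
    moreover have "x i = -1"
      using IJ i by (auto simp: x_def)
    moreover have "mu_density d I \<rho> x = mu_density d J \<rho> x"
      using pmf_mu[of I d \<rho> x] pmf_mu[of J d \<rho> x] IJ assms eq by simp
    ultimately show False
      using assms x by (simp add: mu_density_def)
  qed
  then show ?thesis
    by (intro inj_onI) (metis DiffD1 DiffD2 PowD insertI1 subsetI subset_antisym)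
qed

(* Steps are numbered from 0. The update functions are total on the sample type;
   only their values at the first t * l steps and on memory states matter. *)
record ('x, 'o) mem_alg =
  init :: "bool list"
  upd :: "nat \<Rightarrow> 'x \<Rightarrow> bool list \<Rightarrow> bool list"
  out :: "bool list \<Rightarrow> 'o"

definition mem_states :: "nat \<Rightarrow> bool list set" where
  "mem_states s = {u. length u = s}"

definition is_mem_alg :: "nat \<Rightarrow> nat \<Rightarrow> nat \<Rightarrow> ('x, 'o) mem_alg \<Rightarrow> bool" where
  "is_mem_alg t s l A \<longleftrightarrow>
     init A \<in> mem_states s \<and> (\<forall>j<t * l. \<forall>x. upd A j x \<in> mem_states s \<rightarrow> mem_states s)"

definition passes :: "nat \<Rightarrow> 'x list \<Rightarrow> 'x list" where
  "passes l xs = concat (replicate l xs)"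

primrec mem_state :: "('x, 'o) mem_alg \<Rightarrow> 'x list \<Rightarrow> nat \<Rightarrow> bool list" where
  "mem_state A ys 0 = init A"
| "mem_state A ys (Suc j) = upd A j (ys ! j) (mem_state A ys j)"

definition alg_output :: "nat \<Rightarrow> ('x, 'o) mem_alg \<Rightarrow> 'x list \<Rightarrow> 'o" where
  "alg_output l A xs = out A (mem_state A (passes l xs) (length xs * l))"

definition identifies ::
  "'x pmf set \<Rightarrow> nat \<Rightarrow> nat \<Rightarrow> nat \<Rightarrow> real \<Rightarrow> ('x, 'x pmf) mem_alg \<Rightarrow> bool" where
  "identifies P t s l \<epsilon> A \<longleftrightarrow>
     is_mem_alg t s l A \<and>
     (\<forall>\<mu>\<in>P. measure_pmf.prob (replicate_pmf t \<mu>) {xs. alg_output l A xs = \<mu>} \<ge> 1 - \<epsilon>)"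

end

(* The uniform distribution on the cube is the reference measure, under which the characters of
   the index sets in U are orthonormal. Cut the data into blocks of m^3 samples, where m = |U|. The
   transcript of memory states at all block boundaries, over all passes, has fibres that are
   products of one set R_b per block. So the relative entropy of its law under the uniform measure
   with respect to its law under mu_I is a sum over blocks of E[-ln (1 + q)], q being the mean of
   the likelihood ratio of I minus 1 over R_b. As E[q] = 0, this is at most 2 E[q^2].

   A block of m^3 samples is long enough for linear combinations of its m character sums to be
   subgaussian at the relevant scale, and short enough (this is where rho <= m^(-3) enters) for the
   likelihood ratio to be nearly linear in them. A level-one inequality then bounds the sum of q^2
   over all I by a multiple of m^3 rho^2 ln (1 / P(R_b)). The expectation of ln (1 / P(R_b)) sums
   over the blocks to the entropy of the transcript, of order t s l / m^3. Hence the relative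
   entropies for all I add up to O(rho^2 t s l). On the other hand, under the uniform measure most
   indices are output with small probability, so correctness forces most of these relative
   entropies to be bounded below, and their sum to be of order m. *)

theory Submission
  imports Defs
begin

section \<open>Averages and words\<close>

definition avg :: "('a \<Rightarrow> real) \<Rightarrow> 'a set \<Rightarrow> real" where
  "avg f A = (\<Sum>x\<in>A. f x) / real (card A)"

lemma avg_mono: "(\<And>x. x \<in> A \<Longrightarrow> f x \<le> g x) \<Longrightarrow> avg f A \<le> avg g A"
  unfolding avg_def by (intro divide_right_mono sum_mono) auto

lemma avg_add: "avg (\<lambda>x. f x + g x) A = avg f A + avg g A"
  by (simp add: avg_def sum.distrib add_divide_distrib)

lemma avg_diff: "avg (\<lambda>x. f x - g x) A = avg f A - avg g A"
  by (simp add: avg_def sum_subtractf diff_divide_distrib)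

lemma avg_cmult: "avg (\<lambda>x. c * f x) A = c * avg f A"
  by (simp add: avg_def sum_distrib_left)

lemma avg_const: "finite A \<Longrightarrow> A \<noteq> {} \<Longrightarrow> avg (\<lambda>x. c) A = c"
  by (simp add: avg_def)

lemma avg_sum: "avg (\<lambda>x. \<Sum>i\<in>I. f i x) A = (\<Sum>i\<in>I. avg (f i) A)"
  by (simp add: avg_def sum.swap[of _ A] sum_divide_distrib)

text \<open>Cauchy-Schwarz. On an empty or infinite set both averages are 0, since division by 0
  gives 0.\<close>

lemma avg_square_le: "(avg f A)\<^sup>2 \<le> avg (\<lambda>x. (f x)\<^sup>2) A"
proof (cases "card A = 0")
  case False
  then show ?thesis
    using sum_squared_le_sum_of_squares[of f A]
    by (simp add: avg_def power_divide power2_eq_square field_simps)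
qed (auto simp: avg_def)

text \<open>Jensen's inequality for \<open>exp\<close>: the tangent line at \<open>c\<close> lies
  below the curve, and its average is exactly \<open>exp c\<close>.\<close>

lemma exp_avg_le:
  assumes "finite A" "A \<noteq> {}"
  shows "exp (avg f A) \<le> avg (\<lambda>x. exp (f x)) A"
proof -
  define c where "c = avg f A"
  have "exp c * (1 + (f x - c)) \<le> exp (f x)" for x
    using mult_left_mono[OF exp_ge_add_one_self[of "f x - c"], of "exp c"]
    by (simp add: exp_diff)
  then have "avg (\<lambda>x. exp c * (1 + (f x - c))) A \<le> avg (\<lambda>x. exp (f x)) A"
    by (intro avg_mono) auto
  moreover have "avg (\<lambda>x. exp c * (1 + (f x - c))) A = exp c"
    using assms by (simp only: avg_cmult avg_add avg_diff) (simp add: avg_const c_def)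
  ultimately show ?thesis
    by (simp add: c_def)
qed

section \<open>Words of fixed length as a product space\<close>

definition words :: "'a set \<Rightarrow> nat \<Rightarrow> 'a list set" where
  "words X n = {xs. set xs \<subseteq> X \<and> length xs = n}"

lemma finite_words: "finite X \<Longrightarrow> finite (words X n)"
  unfolding words_def by (rule finite_lists_length_eq)

lemma card_words: "finite X \<Longrightarrow> card (words X n) = card X ^ n"
  unfolding words_def by (rule card_lists_length_eq)

lemma words_nonempty: "X \<noteq> {} \<Longrightarrow> words X n \<noteq> {}"
proof -
  assume "X \<noteq> {}"
  then obtain x where "x \<in> X" by auto
  then have "replicate n x \<in> words X n" by (auto simp: words_def)
  then show ?thesis by auto
qed

lemma words_0 [simp]: "words X 0 = {[]}"
  by (auto simp: words_def)

lemma sum_words_Suc: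
  "(\<Sum>xs\<in>words X (Suc n). f xs) = (\<Sum>x\<in>X. \<Sum>xs\<in>words X n. f (x # xs))"
proof -
  have "(\<Sum>xs\<in>words X (Suc n). f xs) = (\<Sum>p\<in>X \<times> words X n. f (fst p # snd p))"
    by (rule sum.reindex_bij_witness[of _ "\<lambda>p. fst p # snd p" "\<lambda>xs. (hd xs, tl xs)"])
       (auto simp: words_def length_Suc_conv)
  then show ?thesis
    by (simp add: sum.cartesian_product case_prod_beta)
qed

lemma sum_words_add:
  "(\<Sum>xs\<in>words X (a + b). f xs) = (\<Sum>ys\<in>words X a. \<Sum>zs\<in>words X b. f (ys @ zs))"
  by (induction a arbitrary: f) (simp_all add: sum_words_Suc)

text \<open>Independence of the letters under the uniform measure.\<close>

lemma sum_words_prod_list: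
  fixes g :: "'a \<Rightarrow> 'b :: comm_semiring_1"
  shows "(\<Sum>xs\<in>words X n. prod_list (map g xs)) = (\<Sum>x\<in>X. g x) ^ n"
  by (induction n) (simp_all add: sum_words_Suc sum_distrib_left[symmetric] sum_distrib_right[symmetric])

section \<open>Likelihood ratios of sign characters\<close>

text \<open>For \<open>\<phi>\<close> of mean zero, the density with respect to the uniform measure
  on words of the law whose letters are independent with density
  \<open>1 + \<rho> * \<phi> x\<close>.\<close>

definition lik :: "real \<Rightarrow> ('a \<Rightarrow> real) \<Rightarrow> 'a list \<Rightarrow> real" where
  "lik \<rho> \<phi> xs = prod_list (map (\<lambda>x. 1 + \<rho> * \<phi> x) xs)"

text \<open>The derivative of \<open>lik\<close> in \<open>\<rho>\<close> at 0.\<close>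

definition score :: "('a \<Rightarrow> real) \<Rightarrow> 'a list \<Rightarrow> real" where
  "score \<phi> xs = sum_list (map \<phi> xs)"

text \<open>The part of \<open>lik\<close> of degree at least two in \<open>\<rho>\<close>.\<close>

definition lik_rem :: "real \<Rightarrow> ('a \<Rightarrow> real) \<Rightarrow> 'a list \<Rightarrow> real" where
  "lik_rem \<rho> \<phi> xs = lik \<rho> \<phi> xs - 1 - \<rho> * score \<phi> xs"

lemma lik_simps [simp]:
  "lik \<rho> \<phi> [] = 1" "lik \<rho> \<phi> (x # xs) = (1 + \<rho> * \<phi> x) * lik \<rho> \<phi> xs"
  by (simp_all add: lik_def)

lemma lik_append: "lik \<rho> \<phi> (xs @ ys) = lik \<rho> \<phi> xs * lik \<rho> \<phi> ys"
  by (simp add: lik_def)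

lemma score_simps [simp]:
  "score \<phi> [] = 0" "score \<phi> (x # xs) = \<phi> x + score \<phi> xs"
  by (simp_all add: score_def)

text \<open>Splits off one letter so that, for balanced \<open>\<phi>\<close>, the two summands are
  orthogonal; this drives the induction for the second moment.\<close>

lemma lik_rem_Cons:
  "lik_rem \<rho> \<phi> (x # xs) = lik_rem \<rho> \<phi> xs + \<rho> * \<phi> x * (lik \<rho> \<phi> xs - 1)"
  by (simp add: lik_rem_def algebra_simps)

lemma lik_ge:
  assumes "\<And>x. x \<in> X \<Longrightarrow> \<phi> x \<in> {-1, 1}" "0 \<le> \<rho>" "\<rho> \<le> 1" "xs \<in> words X n"
  shows "(1 - \<rho>) ^ n \<le> lik \<rho> \<phi> xs"
  using assms(4)
proof (induction xs arbitrary: n)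
  case (Cons x xs)
  then obtain k where k: "n = Suc k" "xs \<in> words X k" "x \<in> X"
    by (auto simp: words_def)
  have "1 - \<rho> \<le> 1 + \<rho> * \<phi> x"
    using assms(1)[OF k(3)] assms(2) by auto
  then show ?case
    using Cons.IH[OF k(2)] assms(2,3) k(1) by (auto intro!: mult_mono)
qed (simp add: words_def)

lemma abs_score_le:
  assumes "\<And>x. x \<in> X \<Longrightarrow> \<phi> x \<in> {-1, 1}" "xs \<in> words X n"
  shows "\<bar>score \<phi> xs\<bar> \<le> real n"
  using assms(2)
proof (induction xs arbitrary: n)
  case (Cons x xs)
  then obtain k where k: "n = Suc k" "xs \<in> words X k" "x \<in> X"
    by (auto simp: words_def)
  show ?case
    using Cons.IH[OF k(2)] assms(1)[OF k(3)] k(1) by auto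
qed (simp add: words_def)

section \<open>Moments of the likelihood ratio and of its remainder\<close>

context
  fixes X :: "'a set" and \<phi> :: "'a \<Rightarrow> real" and \<rho> :: real
  assumes fin: "finite X" "X \<noteq> {}"
    and signs: "\<And>x. x \<in> X \<Longrightarrow> \<phi> x \<in> {-1, 1}"
    and balanced: "(\<Sum>x\<in>X. \<phi> x) = 0"
begin

lemma sum_words_lik: "(\<Sum>xs\<in>words X n. lik \<rho> \<phi> xs) = real (card (words X n))"
  unfolding lik_def sum_words_prod_list using fin balanced
  by (simp add: sum.distrib sum_distrib_left[symmetric] card_words)

lemma sum_sign_square: "(\<Sum>x\<in>X. (\<phi> x)\<^sup>2) = real (card X)"
proof -
  have "(\<phi> x)\<^sup>2 = 1" if "x \<in> X" for x
    using signs[OF that] by auto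
  then show ?thesis by simp
qed

text \<open>The chi-square divergence of the product law: each letter contributes a factor
  \<open>1 + \<rho>\<^sup>2\<close> to the second moment of \<open>lik\<close>.\<close>

lemma sum_words_lik_minus_1_square:
  "(\<Sum>xs\<in>words X n. (lik \<rho> \<phi> xs - 1)\<^sup>2) = real (card (words X n)) * ((1 + \<rho>\<^sup>2) ^ n - 1)"
proof -
  have "(\<Sum>xs\<in>words X n. (lik \<rho> \<phi> xs)\<^sup>2) = (\<Sum>x\<in>X. (1 + \<rho> * \<phi> x)\<^sup>2) ^ n"
    unfolding sum_words_prod_list[symmetric]
  proof (intro sum.cong refl)
    show "(lik \<rho> \<phi> xs)\<^sup>2 = prod_list (map (\<lambda>x. (1 + \<rho> * \<phi> x)\<^sup>2) xs)" for xs
      by (induction xs) (simp_all add: power_mult_distrib)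
  qed
  also have "(\<Sum>x\<in>X. (1 + \<rho> * \<phi> x)\<^sup>2) = (\<Sum>x\<in>X. 1 + \<phi> x * (2 * \<rho>) + (\<phi> x)\<^sup>2 * \<rho>\<^sup>2)"
    by (intro sum.cong refl) (simp add: power2_eq_square algebra_simps)
  also have "\<dots> = real (card X) * (1 + \<rho>\<^sup>2)"
    using balanced sum_sign_square
    by (simp add: sum.distrib sum_distrib_right[symmetric] ring_distribs)
  finally have sq: "(\<Sum>xs\<in>words X n. (lik \<rho> \<phi> xs)\<^sup>2) = real (card (words X n)) * (1 + \<rho>\<^sup>2) ^ n"
    using fin by (simp add: card_words power_mult_distrib)
  have "(\<Sum>xs\<in>words X n. (lik \<rho> \<phi> xs - 1)\<^sup>2) =
      (\<Sum>xs\<in>words X n. (lik \<rho> \<phi> xs)\<^sup>2 - 2 * lik \<rho> \<phi> xs + 1)"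
    by (intro sum.cong refl) (simp add: power2_eq_square algebra_simps)
  also have "\<dots> = real (card (words X n)) * ((1 + \<rho>\<^sup>2) ^ n - 1)"
    by (simp add: sum.distrib sum_subtractf sum_distrib_left[symmetric] sq sum_words_lik algebra_simps)
  finally show ?thesis .
qed

text \<open>Expanded over sets of positions, \<open>lik\<close> is a sum of orthogonal products of
  signs. Dropping the degrees 0 and 1 removes \<open>1 + real n * \<rho>\<^sup>2\<close> from
  \<open>(1 + \<rho>\<^sup>2) ^ n\<close>.\<close>

lemma sum_words_lik_rem_square:
  "(\<Sum>xs\<in>words X n. (lik_rem \<rho> \<phi> xs)\<^sup>2) =
     real (card (words X n)) * ((1 + \<rho>\<^sup>2) ^ n - 1 - real n * \<rho>\<^sup>2)"
proof (induction n)
  case 0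
  show ?case by (simp add: lik_rem_def)
next
  case (Suc n)
  let ?W = "words X n"
  have "(\<Sum>xs\<in>words X (Suc n). (lik_rem \<rho> \<phi> xs)\<^sup>2) =
      (\<Sum>x\<in>X. \<Sum>xs\<in>?W. (lik_rem \<rho> \<phi> xs)\<^sup>2 + 2 * \<rho> * \<phi> x * (lik_rem \<rho> \<phi> xs * (lik \<rho> \<phi> xs - 1))
          + \<rho>\<^sup>2 * (\<phi> x)\<^sup>2 * (lik \<rho> \<phi> xs - 1)\<^sup>2)"
    unfolding sum_words_Suc lik_rem_Cons
    by (intro sum.cong refl) (simp add: power2_eq_square algebra_simps)
  also have "\<dots> = (\<Sum>x\<in>X. (\<Sum>xs\<in>?W. (lik_rem \<rho> \<phi> xs)\<^sup>2)
      + \<phi> x * (2 * \<rho> * (\<Sum>xs\<in>?W. lik_rem \<rho> \<phi> xs * (lik \<rho> \<phi> xs - 1)))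
      + (\<phi> x)\<^sup>2 * (\<rho>\<^sup>2 * (\<Sum>xs\<in>?W. (lik \<rho> \<phi> xs - 1)\<^sup>2)))"
    by (intro sum.cong refl) (simp add: sum.distrib sum_distrib_left mult_ac)
  \<comment> \<open>The cross term carries the factor \<open>\<Sum>x\<in>X. \<phi> x\<close>, which
    is 0.\<close>
  also have "\<dots> = real (card X) * (\<Sum>xs\<in>?W. (lik_rem \<rho> \<phi> xs)\<^sup>2)
      + real (card X) * (\<rho>\<^sup>2 * (\<Sum>xs\<in>?W. (lik \<rho> \<phi> xs - 1)\<^sup>2))"
    using balanced sum_sign_square by (simp add: sum.distrib sum_distrib_right[symmetric])
  also have "\<dots> = real (card (words X (Suc n))) *
      ((1 + \<rho>\<^sup>2) ^ Suc n - 1 - real (Suc n) * \<rho>\<^sup>2)"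
    unfolding Suc.IH sum_words_lik_minus_1_square using fin
    by (simp add: card_words algebra_simps)
  finally show ?case .
qed

text \<open>The linear term \<open>\<rho> * score \<phi> xs\<close> has mean square
  \<open>real n * \<rho>\<^sup>2\<close>. The remainder is smaller by this factor once more, so the
  likelihood ratio is nearly linear when the factor is small.\<close>

lemma avg_lik_rem_square_le:
  assumes "real n * \<rho>\<^sup>2 \<le> 1"
  shows "avg (\<lambda>xs. (lik_rem \<rho> \<phi> xs)\<^sup>2) (words X n) \<le> (real n * \<rho>\<^sup>2)\<^sup>2"
proof -
  have "(1 + \<rho>\<^sup>2) ^ n \<le> exp (\<rho>\<^sup>2) ^ n"
    by (intro power_mono) auto
  also have "\<dots> = exp (real n * \<rho>\<^sup>2)"
    by (simp add: exp_of_nat_mult)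
  also have "\<dots> \<le> 1 + real n * \<rho>\<^sup>2 + (real n * \<rho>\<^sup>2)\<^sup>2"
    using assms by (intro exp_bound) auto
  finally show ?thesis
    using fin finite_words[OF fin(1), of n] words_nonempty[OF fin(2), of n]
    by (simp add: avg_def sum_words_lik_rem_square)
qed

end

section \<open>A level-one inequality\<close>

lemma exp_le_quadratic:
  fixes z :: real
  assumes "\<bar>z\<bar> \<le> 1"
  shows "exp z \<le> 1 + z + z\<^sup>2"
proof (cases "0 \<le> z")
  case True
  then show ?thesis using assms exp_bound by auto
next
  case False
  define y where "y = - z"
  have y: "0 < y" "y \<le> 1" using False assms by (auto simp: y_def)
  have "exp z = 1 / exp y" by (simp add: y_def exp_minus field_simps)
  also have "\<dots> \<le> 1 / (1 + y)"
    using y exp_ge_add_one_self[of y] by (intro divide_left_mono) auto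
  also have "\<dots> \<le> 1 - y + y\<^sup>2"
  proof -
    have "1 \<le> 1 + y ^ 3" using y by simp
    also have "\<dots> = (1 - y + y\<^sup>2) * (1 + y)"
      by (simp add: power2_eq_square power3_eq_cube algebra_simps)
    finally show ?thesis using y by (simp add: divide_le_eq)
  qed
  finally show ?thesis by (simp add: y_def)
qed

text \<open>The parities in abstract form: sign functions that have mean zero and are orthogonal
  under the uniform measure on \<open>X\<close>.\<close>

locale orthogonal_signs =
  fixes X :: "'a set" and U :: "'i set" and \<phi> :: "'i \<Rightarrow> 'a \<Rightarrow> real"
  assumes finite_X: "finite X" and X_nonempty: "X \<noteq> {}"
    and finite_U: "finite U" and U_nonempty: "U \<noteq> {}"
    and signs: "\<And>i x. i \<in> U \<Longrightarrow> x \<in> X \<Longrightarrow> \<phi> i x \<in> {-1, 1}"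
    and balanced: "\<And>i. i \<in> U \<Longrightarrow> (\<Sum>x\<in>X. \<phi> i x) = 0"
    and orthogonal: "\<And>i j. i \<in> U \<Longrightarrow> j \<in> U \<Longrightarrow> i \<noteq> j \<Longrightarrow> (\<Sum>x\<in>X. \<phi> i x * \<phi> j x) = 0"
begin

text \<open>Parseval's identity, each sign function having mean square 1.\<close>

lemma sum_square_combination:
  "(\<Sum>x\<in>X. (\<Sum>i\<in>U. w i * \<phi> i x)\<^sup>2) = real (card X) * (\<Sum>i\<in>U. (w i)\<^sup>2)"
proof -
  have "(\<Sum>x\<in>X. (\<Sum>i\<in>U. w i * \<phi> i x)\<^sup>2) =
      (\<Sum>x\<in>X. \<Sum>i\<in>U. \<Sum>j\<in>U. w i * w j * (\<phi> i x * \<phi> j x))"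
    by (simp add: power2_eq_square sum_product mult_ac)
  also have "\<dots> = (\<Sum>i\<in>U. \<Sum>j\<in>U. \<Sum>x\<in>X. w i * w j * (\<phi> i x * \<phi> j x))"
    by (subst sum.swap) (intro sum.cong refl sum.swap)
  also have "\<dots> = (\<Sum>i\<in>U. \<Sum>j\<in>U. w i * w j * (\<Sum>x\<in>X. \<phi> i x * \<phi> j x))"
    by (simp add: sum_distrib_left)
  also have "\<dots> = (\<Sum>i\<in>U. \<Sum>j\<in>U. if j = i then (w i)\<^sup>2 * real (card X) else 0)"
  proof (intro sum.cong refl)
    fix i j assume ij: "i \<in> U" "j \<in> U"
    have "\<phi> i x * \<phi> i x = 1" if "x \<in> X" for x
      using signs[OF ij(1) that] by auto
    then show "w i * w j * (\<Sum>x\<in>X. \<phi> i x * \<phi> j x) = (if j = i then (w i)\<^sup>2 * real (card X) else 0)"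
      using orthogonal[OF ij] by (auto simp: power2_eq_square)
  qed
  also have "\<dots> = (\<Sum>i\<in>U. (w i)\<^sup>2 * real (card X))"
    using finite_U by simp
  finally show ?thesis
    by (simp add: sum_distrib_left mult.commute)
qed

lemma score_combination: "score (\<lambda>x. \<Sum>i\<in>U. w i * \<phi> i x) xs = (\<Sum>i\<in>U. w i * score (\<phi> i) xs)"
  by (induction xs) (simp_all add: sum.distrib algebra_simps)

lemma exp_score: "exp (score f xs) = prod_list (map (\<lambda>x. exp (f x)) xs)"
  by (induction xs) (simp_all add: exp_add)

text \<open>Entropy duality: Jensen on \<open>R\<close>, followed by enlarging \<open>R\<close> to
  all words, bounds the mean score on \<open>R\<close> by the logarithm of the inverse density of
  \<open>R\<close> plus that of the exponential moment. For one letter this moment is at most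
  \<open>exp W\<close>: the bound 1 on the combination admits the quadratic estimate of
  \<open>exp\<close>, whose linear term has mean zero and whose quadratic term is given by
  Parseval.\<close>

lemma avg_score_dual:
  assumes R: "R \<subseteq> words X k" "R \<noteq> {}" and "k \<le> n"
    and w: "\<And>x. x \<in> X \<Longrightarrow> \<bar>\<Sum>i\<in>U. w i * \<phi> i x\<bar> \<le> 1"
  shows "(\<Sum>i\<in>U. w i * avg (score (\<phi> i)) R) \<le>
    ln (real (card (words X k)) / real (card R)) + real n * (\<Sum>i\<in>U. (w i)\<^sup>2)"
proof -
  define f where "f x = (\<Sum>i\<in>U. w i * \<phi> i x)" for x
  define W where "W = (\<Sum>i\<in>U. (w i)\<^sup>2)"
  have W: "0 \<le> W" by (simp add: W_def sum_nonneg)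
  have finR: "finite R" using R finite_words[OF finite_X] finite_subset by blast
  have cR: "card R > 0" using finR R by (simp add: card_gt_0_iff)
  have "(\<Sum>x\<in>X. exp (f x)) \<le> (\<Sum>x\<in>X. 1 + f x + (f x)\<^sup>2)"
    using w by (intro sum_mono exp_le_quadratic) (auto simp: f_def)
  also have "\<dots> = real (card X) * (1 + W)"
  proof -
    have "(\<Sum>x\<in>X. f x) = (\<Sum>i\<in>U. w i * (\<Sum>x\<in>X. \<phi> i x))"
      by (simp add: f_def sum.swap[of _ X] sum_distrib_left)
    also have "\<dots> = 0" using balanced by simp
    finally show ?thesis
      using sum_square_combination[of w]
      by (simp add: sum.distrib f_def W_def algebra_simps)
  qed
  also have "\<dots> \<le> real (card X) * exp W"
    by (intro mult_left_mono exp_ge_add_one_self) auto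
  finally have X: "(\<Sum>x\<in>X. exp (f x)) \<le> real (card X) * exp W" .
  have "exp (avg (score f) R) \<le> avg (\<lambda>xs. exp (score f xs)) R"
    by (rule exp_avg_le) (use finR R in auto)
  also have "\<dots> \<le> (\<Sum>xs\<in>words X k. exp (score f xs)) / real (card R)"
    unfolding avg_def using R finite_words[OF finite_X]
    by (intro divide_right_mono sum_mono2) auto
  also have "\<dots> \<le> real (card (words X k)) * exp (real n * W) / real (card R)"
  proof (intro divide_right_mono)
    have "(\<Sum>xs\<in>words X k. exp (score f xs)) = (\<Sum>x\<in>X. exp (f x)) ^ k"
      by (simp add: exp_score sum_words_prod_list)
    also have "\<dots> \<le> (real (card X) * exp W) ^ k"
      using X by (intro power_mono sum_nonneg) auto
    also have "\<dots> = real (card (words X k)) * exp (real k * W)"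
      using finite_X by (simp add: power_mult_distrib card_words exp_of_nat_mult)
    also have "\<dots> \<le> real (card (words X k)) * exp (real n * W)"
      using assms(3) W by (intro mult_left_mono) (auto intro: mult_right_mono)
    finally show "(\<Sum>xs\<in>words X k. exp (score f xs)) \<le> real (card (words X k)) * exp (real n * W)" .
  qed auto
  also have "\<dots> = exp (ln (real (card (words X k)) / real (card R)) + real n * W)"
    using cR words_nonempty[OF X_nonempty] finite_words[OF finite_X]
    by (simp add: exp_add exp_ln card_gt_0_iff)
  finally have "avg (score f) R \<le> ln (real (card (words X k)) / real (card R)) + real n * W"
    by simp
  moreover have "avg (score f) R = (\<Sum>i\<in>U. w i * avg (score (\<phi> i)) R)"
  proof -
    have "score f xs = (\<Sum>i\<in>U. w i * score (\<phi> i) xs)" for xs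
      using score_combination[of w xs] by (simp add: f_def[abs_def])
    then have "avg (score f) R = avg (\<lambda>xs. \<Sum>i\<in>U. w i * score (\<phi> i) xs) R"
      by (simp add: avg_def)
    then show ?thesis by (simp only: avg_sum avg_cmult)
  qed
  ultimately show ?thesis by (simp add: W_def)
qed

text \<open>The weights \<open>v / (2 n)\<close> are optimal in the dual bound, but admissible only if
  \<open>v\<close> has \<open>l\<^sub>1\<close> norm at most \<open>2 n\<close>; otherwise the weights \<open>v\<close> normalised in \<open>l\<^sub>1\<close> show
  that \<open>R\<close> is tiny.\<close>

lemma level_one:
  assumes R: "R \<subseteq> words X k" "R \<noteq> {}" and "k \<le> n" "0 < n"
    and large: "exp (- real n / real (card U)) * real (card (words X k)) < real (card R)"
  shows "(\<Sum>i\<in>U. (avg (score (\<phi> i)) R)\<^sup>2) \<le>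
    4 * real n * ln (real (card (words X k)) / real (card R))"
proof -
  define v where "v i = avg (score (\<phi> i)) R" for i
  define V where "V = (\<Sum>i\<in>U. (v i)\<^sup>2)"
  define N where "N = (\<Sum>i\<in>U. \<bar>v i\<bar>)"
  define D where "D = ln (real (card (words X k)) / real (card R))"
  \<comment> \<open>The weights \<open>c * v i\<close> are admissible in
    \<open>avg_score_dual\<close>, because the characters are signs.\<close>
  have dual: "c * V \<le> D + real n * (c\<^sup>2 * V)" if "0 \<le> c" "c * N \<le> 1" for c
  proof -
    have "\<bar>\<Sum>i\<in>U. c * v i * \<phi> i x\<bar> \<le> 1" if "x \<in> X" for x
    proof -
      have "\<bar>\<Sum>i\<in>U. c * v i * \<phi> i x\<bar> \<le> (\<Sum>i\<in>U. \<bar>c * v i * \<phi> i x\<bar>)"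
        by (rule sum_abs)
      also have "\<dots> = (\<Sum>i\<in>U. c * \<bar>v i\<bar>)"
      proof (intro sum.cong refl)
        fix i assume "i \<in> U"
        then show "\<bar>c * v i * \<phi> i x\<bar> = c * \<bar>v i\<bar>"
          using signs[OF \<open>i \<in> U\<close> \<open>x \<in> X\<close>] \<open>0 \<le> c\<close> by (auto simp: abs_mult)
      qed
      finally show ?thesis
        using \<open>c * N \<le> 1\<close> by (simp add: N_def sum_distrib_left)
    qed
    from avg_score_dual[OF R \<open>k \<le> n\<close> this]
    show ?thesis
      by (simp add: v_def[symmetric] D_def[symmetric] V_def sum_distrib_left power2_eq_square mult_ac)
  qed
  have n: "real n > 0" using \<open>0 < n\<close> by simp
  have V0: "0 \<le> V" by (simp add: V_def sum_nonneg)
  have "V \<le> 4 * real n * D"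
  proof (cases "N \<le> 2 * real n")
    case True
    have "1 / (2 * real n) * V \<le> D + real n * ((1 / (2 * real n))\<^sup>2 * V)"
      using True n by (intro dual) (auto simp: field_simps)
    then show ?thesis
      using n by (simp add: power2_eq_square field_simps)
  next
    case False
    have cU: "real (card U) > 0" using finite_U U_nonempty by (simp add: card_gt_0_iff)
    have cR: "real (card R) > 0"
      using large by (smt (verit) exp_ge_zero mult_nonneg_nonneg of_nat_0_le_iff)
    have cW: "real (card (words X k)) > 0"
      using words_nonempty[OF X_nonempty] finite_words[OF finite_X] by (simp add: card_gt_0_iff)
    have N: "N > 0" "2 * real n \<le> N" using False n by auto
    \<comment> \<open>With \<open>c = 1 / N\<close> and \<open>N \<ge> 2 * real n\<close>, the
      quadratic term costs at most half of the linear one.\<close>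
    have "1 / N * V \<le> D + real n * ((1 / N)\<^sup>2 * V)"
      using N by (intro dual) auto
    moreover have "real n * ((1 / N)\<^sup>2 * V) \<le> 1 / (2 * N) * V"
    proof -
      have "real n * ((1 / N)\<^sup>2 * V) = (real n / N) * (1 / N * V)"
        by (simp add: power2_eq_square)
      also have "\<dots> \<le> (1 / 2) * (1 / N * V)"
        using N V0 by (intro mult_right_mono) (auto simp: field_simps)
      finally show ?thesis by simp
    qed
    ultimately have D: "V / (2 * N) \<le> D" by (simp add: field_simps)
    \<comment> \<open>By Cauchy-Schwarz \<open>D \<ge> V / (2 * N) \<ge> N / (2 * real (card U))
      \<ge> real n / real (card U)\<close>, which contradicts \<open>large\<close>.\<close>
    have "N\<^sup>2 \<le> V * real (card U)"
      using sum_squared_le_sum_of_squares[of "\<lambda>i. \<bar>v i\<bar>" U] by (simp add: N_def V_def)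
    then have "N / (2 * real (card U)) \<le> V / (2 * N)"
      using N cU by (simp add: power2_eq_square field_simps)
    moreover have "real n / real (card U) \<le> N / (2 * real (card U))"
      using N cU by (simp add: field_simps)
    ultimately have "real n / real (card U) \<le> D"
      using D by linarith
    moreover have "D < real n / real (card U)"
    proof -
      have "real (card (words X k)) / real (card R) < exp (real n / real (card U))"
        using large cR by (simp add: exp_minus field_simps)
      then have "D < ln (exp (real n / real (card U)))"
        unfolding D_def using cR cW by (subst ln_less_cancel_iff) auto
      then show ?thesis by simp
    qed
    ultimately show ?thesis by simp
  qed
  then show ?thesis by (simp add: V_def v_def D_def)
qed

end

section \<open>Transcripts with rectangular fibres\<close>

text \<open>If sums over \<open>A\<close> factor through the blocks, a uniform point of
  \<open>A\<close> has a uniform block in \<open>S b\<close>. \<open>A\<close> and \<open>S\<close>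
  are kept abstract to serve both the whole space and a single fibre.\<close>

lemma product_sums_single:
  fixes blk :: "nat \<Rightarrow> 'w \<Rightarrow> 'y" and g :: "'y \<Rightarrow> real"
  assumes prod: "\<And>g :: nat \<Rightarrow> 'y \<Rightarrow> real.
      (\<Sum>x\<in>A. \<Prod>b<K. g b (blk b x)) = (\<Prod>b<K. \<Sum>y\<in>S b. g b y)"
    and b: "b < K" and S: "finite (S b)" "S b \<noteq> {}"
  shows "(\<Sum>x\<in>A. g (blk b x)) = real (card A) * avg g (S b)"
proof -
  define P where "P = (\<Prod>c\<in>{..<K} - {b}. real (card (S c)))"
  have split: "(\<Prod>c<K. h c) = h b * (\<Prod>c\<in>{..<K} - {b}. h c)" for h :: "nat \<Rightarrow> real"
    using b by (intro prod.remove) auto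
  \<comment> \<open>The test functions are \<open>g\<close> on block \<open>b\<close> and the
    constant 1 on every other block.\<close>
  have "(\<Sum>x\<in>A. g (blk b x)) = (\<Sum>x\<in>A. \<Prod>c<K. (if c = b then g else (\<lambda>_. 1)) (blk c x))"
    by (intro sum.cong refl) (simp add: split)
  also have "\<dots> = (\<Prod>c<K. \<Sum>y\<in>S c. (if c = b then g else (\<lambda>_. 1)) y)"
    by (rule prod)
  also have "\<dots> = (\<Sum>y\<in>S b. g y) * P"
    by (simp add: split P_def)
  finally have g: "(\<Sum>x\<in>A. g (blk b x)) = (\<Sum>y\<in>S b. g y) * P" .
  have "real (card A) = (\<Prod>c<K. real (card (S c)))"
    using prod[of "\<lambda>_ _. 1"] by simp
  then have "real (card A) = real (card (S b)) * P"
    by (simp add: split P_def)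
  with g show ?thesis
    using S by (simp add: avg_def)
qed

text \<open>\<open>\<Omega>\<close> with the uniform measure has independent blocks;
  \<open>sum_blk\<close> expresses this by sums of product functions instead of a bijection with a
  product set. \<open>R b p\<close> is the side at block \<open>b\<close> of the rectangle
  \<open>T x = p\<close>.\<close>

locale rectangle_map =
  fixes \<Omega> :: "'w set" and K :: nat and blk :: "nat \<Rightarrow> 'w \<Rightarrow> 'y" and Y :: "nat \<Rightarrow> 'y set"
    and T :: "'w \<Rightarrow> 't" and R :: "nat \<Rightarrow> 't \<Rightarrow> 'y set"
  assumes finite_\<Omega>: "finite \<Omega>" and \<Omega>_nonempty: "\<Omega> \<noteq> {}"
    and finite_Y: "\<And>b. b < K \<Longrightarrow> finite (Y b)"
    and blk_in: "\<And>b x. b < K \<Longrightarrow> x \<in> \<Omega> \<Longrightarrow> blk b x \<in> Y b"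
    and sum_blk: "\<And>g :: nat \<Rightarrow> 'y \<Rightarrow> real.
      (\<Sum>x\<in>\<Omega>. \<Prod>b<K. g b (blk b x)) = (\<Prod>b<K. \<Sum>y\<in>Y b. g b y)"
    and R_subset: "\<And>b p. b < K \<Longrightarrow> R b p \<subseteq> Y b"
    and fibre_iff: "\<And>x p. x \<in> \<Omega> \<Longrightarrow> p \<in> T ` \<Omega> \<Longrightarrow> T x = p \<longleftrightarrow> (\<forall>b<K. blk b x \<in> R b p)"
begin

definition fibre :: "'t \<Rightarrow> 'w set" where
  "fibre p = {x \<in> \<Omega>. T x = p}"

lemma finite_fibre: "finite (fibre p)"
  using finite_\<Omega> by (simp add: fibre_def)

lemma card_\<Omega>_pos: "0 < card \<Omega>"
  using finite_\<Omega> \<Omega>_nonempty by (simp add: card_gt_0_iff)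

lemma Y_nonempty: "b < K \<Longrightarrow> Y b \<noteq> {}"
  using blk_in \<Omega>_nonempty by blast

lemma finite_R: "b < K \<Longrightarrow> finite (R b p)"
  using R_subset finite_Y finite_subset by blast

lemma R_nonempty: "b < K \<Longrightarrow> p \<in> T ` \<Omega> \<Longrightarrow> R b p \<noteq> {}"
  using fibre_iff by blast

lemma card_fibre_pos: "p \<in> T ` \<Omega> \<Longrightarrow> 0 < card (fibre p)"
  using finite_fibre by (auto simp: card_gt_0_iff fibre_def)

text \<open>The indicator of a rectangle is the product of the indicators of its sides, so the test
  functions of \<open>sum_blk\<close> can absorb it.\<close>

lemma sum_fibre:
  fixes g :: "nat \<Rightarrow> 'y \<Rightarrow> real"
  assumes p: "p \<in> T ` \<Omega>"
  shows "(\<Sum>x\<in>fibre p. \<Prod>b<K. g b (blk b x)) = (\<Prod>b<K. \<Sum>y\<in>R b p. g b y)"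
proof -
  have "(\<Sum>x\<in>fibre p. \<Prod>b<K. g b (blk b x)) =
      (\<Sum>x\<in>\<Omega>. if T x = p then \<Prod>b<K. g b (blk b x) else 0)"
    unfolding fibre_def using finite_\<Omega> by (rule sum.inter_filter)
  also have "\<dots> = (\<Sum>x\<in>\<Omega>. \<Prod>b<K. if blk b x \<in> R b p then g b (blk b x) else 0)"
  proof (intro sum.cong refl)
    fix x assume x: "x \<in> \<Omega>"
    show "(if T x = p then \<Prod>b<K. g b (blk b x) else 0) =
        (\<Prod>b<K. if blk b x \<in> R b p then g b (blk b x) else 0)"
    proof (cases "T x = p")
      case True
      then show ?thesis using fibre_iff[OF x p] by simp
    next
      case False
      then obtain b where "b < K" "blk b x \<notin> R b p"
        using fibre_iff[OF x p] by auto
      then have "(\<Prod>b<K. if blk b x \<in> R b p then g b (blk b x) else 0) = 0"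
        by (intro prod_zero) auto
      then show ?thesis using False by simp
    qed
  qed
  also have "\<dots> = (\<Prod>b<K. \<Sum>y\<in>Y b. if y \<in> R b p then g b y else 0)"
    by (rule sum_blk)
  also have "\<dots> = (\<Prod>b<K. \<Sum>y\<in>R b p. g b y)"
  proof (intro prod.cong refl)
    fix b assume "b \<in> {..<K}"
    then show "(\<Sum>y\<in>Y b. if y \<in> R b p then g b y else 0) = (\<Sum>y\<in>R b p. g b y)"
      using R_subset[of b p] finite_Y[of b]
      by (simp add: sum.inter_restrict[symmetric] Int_absorb1)
  qed
  finally show ?thesis .
qed

lemma card_fibre: "p \<in> T ` \<Omega> \<Longrightarrow> real (card (fibre p)) = (\<Prod>b<K. real (card (R b p)))"
  using sum_fibre[of p "\<lambda>_ _. 1"] by simp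

lemma card_\<Omega>: "real (card \<Omega>) = (\<Prod>b<K. real (card (Y b)))"
  using sum_blk[of "\<lambda>_ _. 1"] by simp

text \<open>Conditionally on \<open>T\<close> the blocks remain independent.\<close>

lemma avg_fibre_prod:
  fixes g :: "nat \<Rightarrow> 'y \<Rightarrow> real"
  assumes "p \<in> T ` \<Omega>"
  shows "avg (\<lambda>x. \<Prod>b<K. g b (blk b x)) (fibre p) = (\<Prod>b<K. avg (g b) (R b p))"
  unfolding avg_def by (simp add: sum_fibre[OF assms] card_fibre[OF assms] prod_dividef)

lemma sum_fibre_single:
  "p \<in> T ` \<Omega> \<Longrightarrow> b < K \<Longrightarrow>
    (\<Sum>x\<in>fibre p. g (blk b x)) = real (card (fibre p)) * avg g (R b p)"
  by (rule product_sums_single[where S = "\<lambda>b. R b p", OF sum_fibre]) (simp_all add: finite_R R_nonempty)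

lemma sum_blk_single:
  "b < K \<Longrightarrow> (\<Sum>x\<in>\<Omega>. g (blk b x)) = real (card \<Omega>) * avg g (Y b)"
  by (rule product_sums_single[OF sum_blk]) (simp_all add: finite_Y Y_nonempty)

lemma sum_by_fibres:
  fixes h :: "'w \<Rightarrow> real"
  shows "(\<Sum>x\<in>\<Omega>. h x) = (\<Sum>p\<in>T ` \<Omega>. \<Sum>x\<in>fibre p. h x)"
  unfolding fibre_def using sum.image_gen[OF finite_\<Omega>] .

lemma sum_transcript:
  fixes h :: "'t \<Rightarrow> real"
  shows "(\<Sum>x\<in>\<Omega>. h (T x)) = (\<Sum>p\<in>T ` \<Omega>. real (card (fibre p)) * h p)"
proof -
  have "(\<Sum>x\<in>fibre p. h (T x)) = real (card (fibre p)) * h p" for p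
    by (simp add: fibre_def)
  then show ?thesis by (simp add: sum_by_fibres)
qed

text \<open>Tower property: \<open>avg g (R b (T x))\<close> is the conditional expectation of
  \<open>g (blk b x)\<close> given \<open>T\<close>.\<close>

lemma sum_avg_R:
  "b < K \<Longrightarrow> (\<Sum>x\<in>\<Omega>. avg g (R b (T x))) = real (card \<Omega>) * avg g (Y b)"
  using sum_by_fibres[of "\<lambda>x. g (blk b x)"] sum_transcript[of "\<lambda>p. avg g (R b p)"]
  by (simp add: sum_fibre_single sum_blk_single)

text \<open>A factor that depends on \<open>T\<close> alone passes through the conditional
  expectation given \<open>T\<close>.\<close>

lemma sum_avg_fibre:
  "(\<Sum>x\<in>\<Omega>. avg h (fibre (T x)) * c (T x)) = (\<Sum>x\<in>\<Omega>. h x * c (T x))"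
proof -
  have "(\<Sum>x\<in>\<Omega>. h x * c (T x)) = (\<Sum>p\<in>T ` \<Omega>. \<Sum>x\<in>fibre p. h x * c (T x))"
    by (rule sum_by_fibres)
  also have "\<dots> = (\<Sum>p\<in>T ` \<Omega>. (\<Sum>x\<in>fibre p. h x) * c p)"
    unfolding sum_distrib_right by (intro sum.cong refl) (simp add: fibre_def)
  also have "\<dots> = (\<Sum>p\<in>T ` \<Omega>. real (card (fibre p)) * (avg h (fibre p) * c p))"
    using card_fibre_pos by (intro sum.cong refl) (simp add: avg_def)
  also have "\<dots> = (\<Sum>x\<in>\<Omega>. avg h (fibre (T x)) * c (T x))"
    by (rule sum_transcript[symmetric])
  finally show ?thesis by simp
qed

text \<open>Minus the logarithm of the probability of \<open>R b p\<close> under the uniform measure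
  on \<open>Y b\<close>.\<close>

definition info :: "nat \<Rightarrow> 't \<Rightarrow> real" where
  "info b p = ln (real (card (Y b)) / real (card (R b p)))"

lemma info_nonneg: "b < K \<Longrightarrow> p \<in> T ` \<Omega> \<Longrightarrow> 0 \<le> info b p"
  using card_mono[OF finite_Y R_subset] finite_R R_nonempty
  by (auto simp: info_def card_gt_0_iff intro!: ln_ge_zero)

text \<open>Summed over the blocks, the information content is that of the whole fibre, whose
  mean is the entropy of the transcript.\<close>

lemma sum_info_le:
  "(\<Sum>b<K. \<Sum>x\<in>\<Omega>. info b (T x)) \<le> real (card \<Omega>) * ln (real (card (T ` \<Omega>)))"
proof -
  define M where "M = real (card (T ` \<Omega>))"
  define N where "N = real (card \<Omega>)"
  have M: "0 < M" using finite_\<Omega> \<Omega>_nonempty by (simp add: M_def card_gt_0_iff)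
  have N: "0 < N" using card_\<Omega>_pos by (simp add: N_def)
  have info: "(\<Sum>b<K. info b p) = ln (N / real (card (fibre p)))" if p: "p \<in> T ` \<Omega>" for p
  proof -
    have "N / real (card (fibre p)) = (\<Prod>b<K. real (card (Y b)) / real (card (R b p)))"
      by (simp add: N_def card_\<Omega> card_fibre[OF p] prod_dividef)
    also have "ln \<dots> = (\<Sum>b<K. info b p)"
      unfolding info_def
    proof (rule ln_prod)
      fix b assume "b \<in> {..<K}"
      then show "real (card (Y b)) / real (card (R b p)) \<noteq> 0"
        using finite_Y Y_nonempty finite_R R_nonempty[OF _ p] by (simp add: card_eq_0_iff)
    qed simp
    finally show ?thesis by simp
  qed
  have "(\<Sum>b<K. \<Sum>x\<in>\<Omega>. info b (T x)) = (\<Sum>x\<in>\<Omega>. \<Sum>b<K. info b (T x))"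
    by (rule sum.swap)
  also have "\<dots> = (\<Sum>x\<in>\<Omega>. ln (N / real (card (fibre (T x)))))"
    by (intro sum.cong refl info) simp
  \<comment> \<open>The inequality \<open>ln y \<le> y - 1\<close> compares the law of
    \<open>T\<close> with the uniform law on its \<open>M\<close> values; each fibre contributes
    \<open>N / M\<close> to the middle term, hence \<open>N\<close> in total.\<close>
  also have "\<dots> \<le> (\<Sum>x\<in>\<Omega>. ln M + N / M / real (card (fibre (T x))) - 1)"
  proof (intro sum_mono)
    fix x assume "x \<in> \<Omega>"
    then have F: "0 < real (card (fibre (T x)))" using card_fibre_pos by simp
    have "N / real (card (fibre (T x))) = M * (N / M / real (card (fibre (T x))))"
      using M by simp
    then have "ln (N / real (card (fibre (T x)))) = ln M + ln (N / M / real (card (fibre (T x))))"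
      using M N F by (simp only:) (subst ln_mult_pos, auto)
    also have "ln (N / M / real (card (fibre (T x)))) \<le> N / M / real (card (fibre (T x))) - 1"
      using M N F by (intro ln_le_minus_one) auto
    finally show "ln (N / real (card (fibre (T x)))) \<le> ln M + N / M / real (card (fibre (T x))) - 1"
      by simp
  qed
  also have "\<dots> = N * ln M + (\<Sum>x\<in>\<Omega>. N / M / real (card (fibre (T x)))) - N"
    by (simp add: sum.distrib sum_subtractf N_def)
  also have "(\<Sum>x\<in>\<Omega>. N / M / real (card (fibre (T x)))) = (\<Sum>p\<in>T ` \<Omega>. N / M)"
    using card_fibre_pos by (subst sum_transcript) (intro sum.cong refl, simp)
  also have "\<dots> = N" using M by (simp add: M_def)
  finally show ?thesis by (simp add: M_def N_def)
qed

text \<open>Union bound over the distinct sides at block \<open>b\<close>: a point with a small side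
  has its block in that side, an event of probability at most \<open>\<epsilon>\<close>.\<close>

lemma card_small_rectangle_le:
  assumes b: "b < K" and \<epsilon>: "0 \<le> \<epsilon>"
  shows "real (card {x \<in> \<Omega>. real (card (R b (T x))) \<le> \<epsilon> * real (card (Y b))}) \<le>
    real (card (R b ` T ` \<Omega>)) * \<epsilon> * real (card \<Omega>)"
proof -
  define \<S> where "\<S> = {S \<in> R b ` T ` \<Omega>. real (card S) \<le> \<epsilon> * real (card (Y b))}"
  have fin: "finite \<S>" using finite_\<Omega> by (simp add: \<S>_def)
  have "card {x \<in> \<Omega>. real (card (R b (T x))) \<le> \<epsilon> * real (card (Y b))} \<le>
      card (\<Union>S\<in>\<S>. {x \<in> \<Omega>. blk b x \<in> S})"
  proof (intro card_mono subsetI)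
    fix x assume "x \<in> {x \<in> \<Omega>. real (card (R b (T x))) \<le> \<epsilon> * real (card (Y b))}"
    then show "x \<in> (\<Union>S\<in>\<S>. {x \<in> \<Omega>. blk b x \<in> S})"
      using fibre_iff[of x "T x"] b by (auto simp: \<S>_def)
  qed (use fin finite_\<Omega> in auto)
  also have "\<dots> \<le> (\<Sum>S\<in>\<S>. card {x \<in> \<Omega>. blk b x \<in> S})"
    using fin by (rule card_UN_le)
  finally have "real (card {x \<in> \<Omega>. real (card (R b (T x))) \<le> \<epsilon> * real (card (Y b))}) \<le>
      (\<Sum>S\<in>\<S>. real (card {x \<in> \<Omega>. blk b x \<in> S}))"
    by (simp flip: of_nat_sum)
  also have "\<dots> \<le> (\<Sum>S\<in>\<S>. \<epsilon> * real (card \<Omega>))"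
  proof (intro sum_mono)
    fix S assume S: "S \<in> \<S>"
    then have sub: "S \<subseteq> Y b" using R_subset[OF b] by (auto simp: \<S>_def)
    have cY: "0 < card (Y b)" using finite_Y[OF b] Y_nonempty[OF b] by (simp add: card_gt_0_iff)
    have "real (card {x \<in> \<Omega>. blk b x \<in> S}) = (\<Sum>x\<in>\<Omega>. if blk b x \<in> S then 1 else 0)"
      using finite_\<Omega> by (simp add: sum.inter_filter[symmetric])
    also have "\<dots> = real (card \<Omega>) * avg (\<lambda>y. if y \<in> S then 1 else 0) (Y b)"
      by (rule sum_blk_single[OF b])
    also have "avg (\<lambda>y. if y \<in> S then 1 else 0) (Y b) = real (card S) / real (card (Y b))"
      using sub finite_Y[OF b] by (simp add: avg_def sum.inter_restrict[symmetric] Int_absorb1)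
    also have "real (card \<Omega>) * (real (card S) / real (card (Y b))) \<le> real (card \<Omega>) * \<epsilon>"
      using S cY by (intro mult_left_mono) (auto simp: \<S>_def divide_le_eq)
    finally show "real (card {x \<in> \<Omega>. blk b x \<in> S}) \<le> \<epsilon> * real (card \<Omega>)"
      by (simp add: mult.commute)
  qed
  also have "\<dots> = real (card \<S>) * (\<epsilon> * real (card \<Omega>))" by simp
  also have "\<dots> \<le> real (card (R b ` T ` \<Omega>)) * (\<epsilon> * real (card \<Omega>))"
    using \<epsilon> finite_\<Omega> by (intro mult_right_mono) (auto simp: \<S>_def intro!: card_mono)
  finally show ?thesis by (simp add: mult.assoc)
qed

end

section \<open>Divergence of the transcripts\<close>

lemma minus_ln_le_quadratic:
  fixes q :: real
  assumes "- 1 / 2 \<le> q"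
  shows "- ln (1 + q) \<le> - q + 2 * q\<^sup>2"
proof -
  consider "q \<le> 1 / 2" | "1 / 2 \<le> q" by linarith
  then show ?thesis
  proof cases
    case 1
    then have "\<bar>ln (1 + q) - q\<bar> \<le> 2 * q\<^sup>2"
      using assms by (intro abs_ln_one_plus_x_minus_x_bound) auto
    then show ?thesis by linarith
  next
    case 2
    then have "0 \<le> ln (1 + q)" by simp
    moreover have "0 \<le> q * (2 * q - 1)" using 2 by simp
    ultimately show ?thesis by (simp add: power2_eq_square algebra_simps)
  qed
qed

text \<open>Blocks may be shorter than \<open>n\<close>, as the last one usually is.
  \<open>H\<close> counts the distinct sides at a single block, for the union bound over small
  sides.\<close>

locale block_protocol =
  orthogonal_signs X U \<phi> + rectangle_map \<Omega> K blk "\<lambda>b. words X (len b)" T R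
  for X :: "'a set" and U :: "'i set" and \<phi> :: "'i \<Rightarrow> 'a \<Rightarrow> real"
    and \<Omega> :: "'w set" and K :: nat and blk :: "nat \<Rightarrow> 'w \<Rightarrow> 'a list" and len :: "nat \<Rightarrow> nat"
    and T :: "'w \<Rightarrow> 't" and R :: "nat \<Rightarrow> 't \<Rightarrow> 'a list set" +
  fixes n :: nat and \<rho> H :: real
  assumes len_le: "\<And>b. b < K \<Longrightarrow> len b \<le> n" and n_pos: "0 < n"
    and \<rho>_nonneg: "0 \<le> \<rho>" and \<rho>_le: "real n * \<rho> \<le> 1 / 2"
    and card_rectangles: "\<And>b. b < K \<Longrightarrow> real (card (R b ` T ` \<Omega>)) \<le> H"
begin

text \<open>\<open>1 + shift i b p\<close> is the ratio of the probabilities of the side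
  \<open>R b p\<close> under index \<open>i\<close> and under the uniform measure.\<close>

definition shift :: "'i \<Rightarrow> nat \<Rightarrow> 't \<Rightarrow> real" where
  "shift i b p = avg (lik \<rho> (\<phi> i)) (R b p) - 1"

lemma \<rho>_le_half: "\<rho> \<le> 1 / 2"
proof -
  have "1 * \<rho> \<le> real n * \<rho>" using n_pos \<rho>_nonneg by (intro mult_right_mono) auto
  then show ?thesis using \<rho>_le by simp
qed

lemma n_\<rho>_square_le: "real n * \<rho>\<^sup>2 \<le> 1"
proof -
  have "real n * \<rho>\<^sup>2 = (real n * \<rho>) * \<rho>" by (simp add: power2_eq_square)
  also have "\<dots> \<le> 1 / 2 * (1 / 2)"
    using \<rho>_le \<rho>_le_half \<rho>_nonneg by (intro mult_mono) auto
  finally show ?thesis by simp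
qed

lemma sum_shift: "i \<in> U \<Longrightarrow> b < K \<Longrightarrow> (\<Sum>x\<in>\<Omega>. shift i b (T x)) = 0"
proof -
  assume i: "i \<in> U" and b: "b < K"
  have "(\<Sum>xs\<in>words X (len b). lik \<rho> (\<phi> i) xs) = real (card (words X (len b)))"
    using finite_X X_nonempty signs[OF i] balanced[OF i] by (intro sum_words_lik) auto
  then have "avg (lik \<rho> (\<phi> i)) (words X (len b)) = 1"
    using finite_Y[OF b] Y_nonempty[OF b] by (simp add: avg_def)
  then show ?thesis
    using sum_avg_R[OF b, of "lik \<rho> (\<phi> i)"] by (simp add: shift_def sum_subtractf)
qed

text \<open>The likelihood ratio of a block is at least
  \<open>(1 - \<rho>) ^ n \<ge> 1 - real n * \<rho> \<ge> 1 / 2\<close>. This puts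
  \<open>shift\<close> in the range of \<open>minus_ln_le_quadratic\<close>.\<close>

lemma shift_ge:
  assumes "i \<in> U" "b < K" "p \<in> T ` \<Omega>"
  shows "- 1 / 2 \<le> shift i b p"
proof -
  have "1 - real n * \<rho> \<le> (1 - \<rho>) ^ n"
    using Bernoulli_inequality[of "- \<rho>" n] \<rho>_le_half by simp
  also have "\<dots> \<le> (1 - \<rho>) ^ len b"
    using len_le[OF assms(2)] \<rho>_nonneg \<rho>_le_half by (intro power_decreasing) auto
  finally have l: "1 / 2 \<le> (1 - \<rho>) ^ len b" using \<rho>_le by simp
  have "avg (\<lambda>_. 1 / 2) (R b p) \<le> avg (lik \<rho> (\<phi> i)) (R b p)"
  proof (rule avg_mono)
    fix xs assume "xs \<in> R b p"
    then have "xs \<in> words X (len b)" using R_subset[OF assms(2)] by auto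
    then have "(1 - \<rho>) ^ len b \<le> lik \<rho> (\<phi> i) xs"
      using signs[OF assms(1)] \<rho>_nonneg \<rho>_le_half by (intro lik_ge[of X]) auto
    then show "1 / 2 \<le> lik \<rho> (\<phi> i) xs" using l by linarith
  qed
  then show ?thesis
    using finite_R[OF assms(2)] R_nonempty[OF assms(2,3)] by (simp add: avg_const shift_def)
qed

text \<open>The likelihood ratio minus 1 is \<open>\<rho>\<close> times the score plus the
  remainder. The score is controlled by \<open>level_one\<close> off the small sides, the remainder
  by its second moment and the tower property.\<close>

lemma sum_shift_square_le:
  assumes b: "b < K"
  defines "m \<equiv> real (card U)"
  shows "(\<Sum>x\<in>\<Omega>. \<Sum>i\<in>U. (shift i b (T x))\<^sup>2) \<le>
    8 * real n * \<rho>\<^sup>2 * (\<Sum>x\<in>\<Omega>. info b (T x)) +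
    real (card \<Omega>) * (2 * \<rho>\<^sup>2 * m * (real n)\<^sup>2 * H * exp (- real n / m) + 2 * m * (real n * \<rho>\<^sup>2)\<^sup>2)"
proof -
  define v where "v i p = avg (score (\<phi> i)) (R b p)" for i p
  define w where "w i p = avg (lik_rem \<rho> (\<phi> i)) (R b p)" for i p
  \<comment> \<open>The size below which \<open>level_one\<close> does not apply.\<close>
  define small where "small = {x \<in> \<Omega>. real (card (R b (T x))) \<le> exp (- real n / m) * real (card (words X (len b)))}"
  have N: "0 \<le> real (card \<Omega>)" by simp
  have pointwise: "(shift i b (T x))\<^sup>2 \<le> 2 * \<rho>\<^sup>2 * (v i (T x))\<^sup>2 + 2 * (w i (T x))\<^sup>2" if "x \<in> \<Omega>" for i x
  proof -
    have "avg (lik \<rho> (\<phi> i)) (R b (T x)) =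
        avg (\<lambda>xs. 1 + (\<rho> * score (\<phi> i) xs + lik_rem \<rho> (\<phi> i) xs)) (R b (T x))"
      by (simp add: lik_rem_def)
    also have "\<dots> = avg (\<lambda>xs. 1) (R b (T x)) + (\<rho> * v i (T x) + w i (T x))"
      by (simp only: avg_add avg_cmult v_def w_def)
    also have "avg (\<lambda>xs. 1) (R b (T x)) = 1"
      using finite_R[OF b] R_nonempty[OF b] that by (intro avg_const) auto
    finally have "shift i b (T x) = \<rho> * v i (T x) + w i (T x)"
      by (simp add: shift_def)
    then show ?thesis
      using sum_squares_ge_zero[of "\<rho> * v i (T x) - w i (T x)" 0]
      by (simp add: power2_eq_square algebra_simps)
  qed
  have w: "(\<Sum>x\<in>\<Omega>. (w i (T x))\<^sup>2) \<le> real (card \<Omega>) * (real n * \<rho>\<^sup>2)\<^sup>2" if i: "i \<in> U" for i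
  proof -
    have n: "real (len b) * \<rho>\<^sup>2 \<le> real n * \<rho>\<^sup>2"
      using len_le[OF b] by (intro mult_right_mono) auto
    have "(\<Sum>x\<in>\<Omega>. (w i (T x))\<^sup>2) \<le> (\<Sum>x\<in>\<Omega>. avg (\<lambda>xs. (lik_rem \<rho> (\<phi> i) xs)\<^sup>2) (R b (T x)))"
      unfolding w_def by (intro sum_mono avg_square_le)
    also have "\<dots> = real (card \<Omega>) * avg (\<lambda>xs. (lik_rem \<rho> (\<phi> i) xs)\<^sup>2) (words X (len b))"
      by (rule sum_avg_R[OF b])
    also have "\<dots> \<le> real (card \<Omega>) * (real (len b) * \<rho>\<^sup>2)\<^sup>2"
      using finite_X X_nonempty signs[OF i] balanced[OF i] n n_\<rho>_square_le
      by (intro mult_left_mono avg_lik_rem_square_le) auto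
    also have "\<dots> \<le> real (card \<Omega>) * (real n * \<rho>\<^sup>2)\<^sup>2"
      using n by (intro mult_left_mono power_mono) auto
    finally show ?thesis .
  qed
  have v: "(\<Sum>i\<in>U. (v i (T x))\<^sup>2) \<le>
      4 * real n * info b (T x) + m * (real n)\<^sup>2 * (if x \<in> small then 1 else 0)" if x: "x \<in> \<Omega>" for x
  proof (cases "x \<in> small")
    case False
    then have "exp (- real n / real (card U)) * real (card (words X (len b))) < real (card (R b (T x)))"
      using x by (simp add: small_def m_def)
    from level_one[OF R_subset[OF b] R_nonempty[OF b] len_le[OF b] n_pos this]
    show ?thesis using False x by (simp add: v_def info_def)
  next
    case True
    \<comment> \<open>On a small side only the trivial bound on the score is left; the small
      probability of such sides makes up for it.\<close>
    have "(v i (T x))\<^sup>2 \<le> (real n)\<^sup>2" if i: "i \<in> U" for i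
    proof -
      have "(v i (T x))\<^sup>2 \<le> avg (\<lambda>xs. (score (\<phi> i) xs)\<^sup>2) (R b (T x))"
        unfolding v_def by (rule avg_square_le)
      also have "\<dots> \<le> avg (\<lambda>xs. (real n)\<^sup>2) (R b (T x))"
      proof (rule avg_mono)
        fix xs assume "xs \<in> R b (T x)"
        then have "xs \<in> words X (len b)" using R_subset[OF b] by auto
        then have "\<bar>score (\<phi> i) xs\<bar> \<le> real (len b)"
          using signs[OF i] by (intro abs_score_le[of X]) auto
        also have "\<dots> \<le> real n" using len_le[OF b] by simp
        finally show "(score (\<phi> i) xs)\<^sup>2 \<le> (real n)\<^sup>2"
          by (simp add: abs_le_square_iff[symmetric])
      qed
      also have "\<dots> = (real n)\<^sup>2"
        using finite_R[OF b] R_nonempty[OF b] x by (intro avg_const) auto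
      finally show ?thesis .
    qed
    then have "(\<Sum>i\<in>U. (v i (T x))\<^sup>2) \<le> (\<Sum>i\<in>U. (real n)\<^sup>2)" by (rule sum_mono)
    also have "\<dots> = m * (real n)\<^sup>2" by (simp add: m_def)
    finally show ?thesis
      using True info_nonneg[OF b, of "T x"] x by (simp add: add_increasing)
  qed
  have "(\<Sum>x\<in>\<Omega>. \<Sum>i\<in>U. (shift i b (T x))\<^sup>2) \<le>
      (\<Sum>x\<in>\<Omega>. \<Sum>i\<in>U. 2 * \<rho>\<^sup>2 * (v i (T x))\<^sup>2 + 2 * (w i (T x))\<^sup>2)"
    by (intro sum_mono pointwise)
  also have "\<dots> = 2 * \<rho>\<^sup>2 * (\<Sum>x\<in>\<Omega>. \<Sum>i\<in>U. (v i (T x))\<^sup>2) + 2 * (\<Sum>i\<in>U. \<Sum>x\<in>\<Omega>. (w i (T x))\<^sup>2)"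
    by (simp add: sum.distrib sum_distrib_left sum.swap[of _ \<Omega> U])
  also have "\<dots> \<le> 2 * \<rho>\<^sup>2 * (4 * real n * (\<Sum>x\<in>\<Omega>. info b (T x)) + m * (real n)\<^sup>2 * real (card small))
      + 2 * (m * (real (card \<Omega>) * (real n * \<rho>\<^sup>2)\<^sup>2))"
  proof (intro add_mono mult_left_mono)
    have "(\<Sum>x\<in>\<Omega>. \<Sum>i\<in>U. (v i (T x))\<^sup>2) \<le>
        (\<Sum>x\<in>\<Omega>. 4 * real n * info b (T x) + m * (real n)\<^sup>2 * (if x \<in> small then 1 else 0))"
      by (intro sum_mono v)
    also have "\<dots> = 4 * real n * (\<Sum>x\<in>\<Omega>. info b (T x))
        + m * (real n)\<^sup>2 * (\<Sum>x\<in>\<Omega>. if x \<in> small then 1 else 0)"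
      by (simp add: sum.distrib sum_distrib_left)
    also have "(\<Sum>x\<in>\<Omega>. if x \<in> small then 1 else 0) = real (card small)"
      using finite_\<Omega> by (simp add: sum.inter_filter[symmetric] small_def)
    finally show "(\<Sum>x\<in>\<Omega>. \<Sum>i\<in>U. (v i (T x))\<^sup>2) \<le>
        4 * real n * (\<Sum>x\<in>\<Omega>. info b (T x)) + m * (real n)\<^sup>2 * real (card small)" .
    show "(\<Sum>i\<in>U. \<Sum>x\<in>\<Omega>. (w i (T x))\<^sup>2) \<le> m * (real (card \<Omega>) * (real n * \<rho>\<^sup>2)\<^sup>2)"
      using sum_mono[of U, OF w] by (simp add: m_def)
  qed auto
  also have "\<dots> \<le> 2 * \<rho>\<^sup>2 * (4 * real n * (\<Sum>x\<in>\<Omega>. info b (T x))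
        + m * (real n)\<^sup>2 * (H * exp (- real n / m) * real (card \<Omega>)))
      + 2 * (m * (real (card \<Omega>) * (real n * \<rho>\<^sup>2)\<^sup>2))"
  proof (intro add_mono mult_left_mono order.refl)
    have "real (card small) \<le> real (card (R b ` T ` \<Omega>)) * exp (- real n / m) * real (card \<Omega>)"
      unfolding small_def by (rule card_small_rectangle_le[OF b]) simp
    also have "\<dots> \<le> H * exp (- real n / m) * real (card \<Omega>)"
      using card_rectangles[OF b] by (intro mult_right_mono) auto
    finally show "real (card small) \<le> H * exp (- real n / m) * real (card \<Omega>)" .
  qed (auto simp: m_def)
  finally show ?thesis
    by (simp add: algebra_simps)
qed

text \<open>Its average over \<open>fibre p\<close> is the ratio of the probabilities of the
  transcript \<open>p\<close> under index \<open>i\<close> and under the uniform measure.\<close>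

definition lik_whole :: "'i \<Rightarrow> 'w \<Rightarrow> real" where
  "lik_whole i x = (\<Prod>b<K. lik \<rho> (\<phi> i) (blk b x))"

lemma avg_lik_whole:
  "p \<in> T ` \<Omega> \<Longrightarrow> avg (lik_whole i) (fibre p) = (\<Prod>b<K. 1 + shift i b p)"
  using avg_fibre_prod[of p "\<lambda>_. lik \<rho> (\<phi> i)"] by (simp add: lik_whole_def[abs_def] shift_def)

text \<open>The left side is \<open>real (card \<Omega>)\<close> times the sum of the relative
  entropies of the transcript. The logarithm splits over the blocks, the linear terms cancel by
  \<open>sum_shift\<close>, and \<open>sum_info_le\<close> collects the information.\<close>

lemma divergence_le:
  defines "m \<equiv> real (card U)"
  shows "(\<Sum>i\<in>U. \<Sum>x\<in>\<Omega>. - ln (avg (lik_whole i) (fibre (T x)))) \<le>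
    real (card \<Omega>) * (16 * real n * \<rho>\<^sup>2 * ln (real (card (T ` \<Omega>))) +
      real K * (4 * \<rho>\<^sup>2 * m * (real n)\<^sup>2 * H * exp (- real n / m) + 4 * m * (real n * \<rho>\<^sup>2)\<^sup>2))"
proof -
  let ?E = "2 * \<rho>\<^sup>2 * m * (real n)\<^sup>2 * H * exp (- real n / m) + 2 * m * (real n * \<rho>\<^sup>2)\<^sup>2"
  have "(\<Sum>x\<in>\<Omega>. - ln (avg (lik_whole i) (fibre (T x)))) \<le> (\<Sum>b<K. \<Sum>x\<in>\<Omega>. 2 * (shift i b (T x))\<^sup>2)"
    if i: "i \<in> U" for i
  proof -
    have "(\<Sum>x\<in>\<Omega>. - ln (avg (lik_whole i) (fibre (T x)))) =
        (\<Sum>x\<in>\<Omega>. \<Sum>b<K. - ln (1 + shift i b (T x)))"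
    proof (intro sum.cong refl)
      fix x assume x: "x \<in> \<Omega>"
      have "1 + shift i b (T x) \<noteq> 0" if "b < K" for b
        using shift_ge[OF i that, of "T x"] x by auto
      then have "ln (\<Prod>b<K. 1 + shift i b (T x)) = (\<Sum>b<K. ln (1 + shift i b (T x)))"
        by (intro ln_prod) auto
      then show "- ln (avg (lik_whole i) (fibre (T x))) = (\<Sum>b<K. - ln (1 + shift i b (T x)))"
        using x by (simp add: avg_lik_whole sum_negf)
    qed
    also have "\<dots> \<le> (\<Sum>x\<in>\<Omega>. \<Sum>b<K. - shift i b (T x) + 2 * (shift i b (T x))\<^sup>2)"
      using shift_ge[OF i] by (intro sum_mono minus_ln_le_quadratic) auto
    also have "\<dots> = (\<Sum>b<K. \<Sum>x\<in>\<Omega>. - shift i b (T x) + 2 * (shift i b (T x))\<^sup>2)"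
      by (rule sum.swap)
    also have "\<dots> = (\<Sum>b<K. \<Sum>x\<in>\<Omega>. 2 * (shift i b (T x))\<^sup>2)"
      by (rule sum.cong[OF refl]) (use sum_shift[OF i] in \<open>simp add: sum_subtractf\<close>)
    finally show ?thesis .
  qed
  then have "(\<Sum>i\<in>U. \<Sum>x\<in>\<Omega>. - ln (avg (lik_whole i) (fibre (T x)))) \<le>
      (\<Sum>i\<in>U. \<Sum>b<K. \<Sum>x\<in>\<Omega>. 2 * (shift i b (T x))\<^sup>2)"
    by (rule sum_mono)
  also have "\<dots> = (\<Sum>b<K. 2 * (\<Sum>x\<in>\<Omega>. \<Sum>i\<in>U. (shift i b (T x))\<^sup>2))"
    by (subst sum.swap) (simp add: sum_distrib_left sum.swap[of _ U \<Omega>])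
  also have "\<dots> \<le> (\<Sum>b<K. 2 * (8 * real n * \<rho>\<^sup>2 * (\<Sum>x\<in>\<Omega>. info b (T x)) + real (card \<Omega>) * ?E))"
    unfolding m_def by (intro sum_mono mult_left_mono sum_shift_square_le) auto
  also have "\<dots> = 16 * real n * \<rho>\<^sup>2 * (\<Sum>b<K. \<Sum>x\<in>\<Omega>. info b (T x)) + 2 * real K * (real (card \<Omega>) * ?E)"
    by (simp add: sum.distrib sum_distrib_left algebra_simps)
  also have "\<dots> \<le> 16 * real n * \<rho>\<^sup>2 * (real (card \<Omega>) * ln (real (card (T ` \<Omega>))))
      + 2 * real K * (real (card \<Omega>) * ?E)"
    by (intro add_right_mono mult_left_mono sum_info_le) auto
  finally show ?thesis by (simp add: algebra_simps)
qed

end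

section \<open>Block structure of a multi-pass algorithm\<close>

lemma take_drop_append_word:
  assumes "ys \<in> words X (min n t)" "zs \<in> words X (t - n)"
  shows "take n (ys @ zs) = ys" "drop n (ys @ zs) = zs"
  using assms by (cases "n \<le> t"; simp add: words_def)+

text \<open>Induction that splits off the first block. Truncated subtraction makes the last block
  short and any block past the end empty.\<close>

lemma sum_words_blocks:
  fixes g :: "nat \<Rightarrow> 'a list \<Rightarrow> real"
  assumes "t \<le> K * n"
  shows "(\<Sum>xs\<in>words X t. \<Prod>b<K. g b (take n (drop (b * n) xs))) =
    (\<Prod>b<K. \<Sum>ys\<in>words X (min n (t - b * n)). g b ys)"
  using assms
proof (induction K arbitrary: t g)
  case (Suc K)
  have t: "min n t + (t - n) = t" by simp
  have IH: "(\<Sum>zs\<in>words X (t - n). \<Prod>b<K. g (Suc b) (take n (drop (b * n) zs))) =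
      (\<Prod>b<K. \<Sum>ys\<in>words X (min n (t - Suc b * n)). g (Suc b) ys)"
    using Suc.prems Suc.IH[of "t - n" "\<lambda>b. g (Suc b)"] by (simp add: diff_diff_left)
  have "(\<Sum>xs\<in>words X t. \<Prod>b<Suc K. g b (take n (drop (b * n) xs))) =
      (\<Sum>ys\<in>words X (min n t). \<Sum>zs\<in>words X (t - n).
        \<Prod>b<Suc K. g b (take n (drop (b * n) (ys @ zs))))"
    using sum_words_add[of "\<lambda>xs. \<Prod>b<Suc K. g b (take n (drop (b * n) xs))" X "min n t" "t - n"]
    by (simp only: t)
  also have "\<dots> = (\<Sum>ys\<in>words X (min n t). \<Sum>zs\<in>words X (t - n).
        g 0 ys * (\<Prod>b<K. g (Suc b) (take n (drop (b * n) zs))))"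
  proof (intro sum.cong refl)
    fix ys zs assume yz: "ys \<in> words X (min n t)" "zs \<in> words X (t - n)"
    have "drop (Suc b * n) (ys @ zs) = drop (b * n) zs" for b
      using take_drop_append_word(2)[OF yz] by (metis drop_drop mult_Suc add.commute)
    then show "(\<Prod>b<Suc K. g b (take n (drop (b * n) (ys @ zs)))) =
        g 0 ys * (\<Prod>b<K. g (Suc b) (take n (drop (b * n) zs)))"
      using take_drop_append_word(1)[OF yz]
      by (simp only: prod.lessThan_Suc_shift mult_0 drop_0)
  qed
  also have "\<dots> = (\<Sum>ys\<in>words X (min n t). g 0 ys) *
      (\<Prod>b<K. \<Sum>ys\<in>words X (min n (t - Suc b * n)). g (Suc b) ys)"
    by (simp only: sum_distrib_left[symmetric] sum_distrib_right[symmetric] IH)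
  also have "\<dots> = (\<Prod>b<Suc K. \<Sum>ys\<in>words X (min n (t - b * n)). g b ys)"
    by (simp only: prod.lessThan_Suc_shift mult_0 diff_zero)
  finally show ?case .
qed simp

lemma lik_blocks:
  "length xs \<le> K * n \<Longrightarrow> lik \<rho> \<phi> xs = (\<Prod>b<K. lik \<rho> \<phi> (take n (drop (b * n) xs)))"
proof (induction K arbitrary: xs)
  case (Suc K)
  have "lik \<rho> \<phi> xs = lik \<rho> \<phi> (take n xs) * lik \<rho> \<phi> (drop n xs)"
    by (simp flip: lik_append)
  also have "lik \<rho> \<phi> (drop n xs) = (\<Prod>b<K. lik \<rho> \<phi> (take n (drop (b * n) (drop n xs))))"
    using Suc.prems by (intro Suc.IH) auto
  finally show ?case
    by (simp add: prod.lessThan_Suc_shift add.commute del: prod.lessThan_Suc)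
qed simp

section \<open>Memory states along segments and passes\<close>

primrec run :: "('x, 'o) mem_alg \<Rightarrow> nat \<Rightarrow> bool list \<Rightarrow> 'x list \<Rightarrow> bool list" where
  "run A j u [] = u"
| "run A j u (x # xs) = run A (Suc j) (upd A j x u) xs"

text \<open>A segment of the input acts on the memory only through its content and its starting
  step; this is what makes the fibres rectangles.\<close>

lemma mem_state_run:
  "take (length ys) (drop j zs) = ys \<Longrightarrow>
    mem_state A zs (j + length ys) = run A j (mem_state A zs j) ys"
proof (induction ys arbitrary: j)
  case (Cons y ys)
  then have "j < length zs"
    by (cases "j < length zs") auto
  then have "drop j zs = zs ! j # drop (Suc j) zs"
    by (simp add: Cons_nth_drop_Suc)
  then have "zs ! j = y" "take (length ys) (drop (Suc j) zs) = ys"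
    using Cons.prems by simp_all
  then show ?case
    using Cons.IH[of "Suc j"] by simp
qed simp

lemma passes_add: "passes (a + b) xs = passes a xs @ passes b xs"
  by (simp add: passes_def replicate_add)

lemma length_passes: "length (passes l xs) = l * length xs"
  by (simp add: passes_def length_concat sum_list_replicate)

lemma take_drop_passes:
  assumes "r < l" "a + k \<le> length xs"
  shows "take k (drop (r * length xs + a) (passes l xs)) = take k (drop a xs)"
proof -
  obtain l' where "l = r + Suc l'" using assms(1) less_imp_Suc_add by auto
  then have "passes l xs = passes r xs @ xs @ passes l' xs"
    using passes_add[of r "Suc l'" xs] by (simp add: passes_def)
  then show ?thesis using assms(2) by (simp add: length_passes)
qed

lemma card_mem_states: "card (mem_states s) = 2 ^ s"
  using card_words[of "UNIV :: bool set" s] by (simp add: mem_states_def words_def)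

lemma finite_mem_states: "finite (mem_states s)"
  using card_mem_states[of s] card_ge_0_finite by force

section \<open>Transcripts of an algorithm and their rectangles\<close>

locale blocked_algorithm =
  fixes X :: "'x set" and t s l n K :: nat and A :: "('x, 'o) mem_alg"
  assumes fin_X: "finite X" and ne_X: "X \<noteq> {}"
    and alg: "is_mem_alg t s l A" and l_pos: "0 < l" and blocks: "t \<le> K * n"
begin

definition len :: "nat \<Rightarrow> nat" where "len b = min n (t - b * n)"

definition block :: "nat \<Rightarrow> 'x list \<Rightarrow> 'x list" where
  "block b xs = take n (drop (b * n) xs)"

text \<open>The \<open>min\<close> moves boundaries past the end of the data to the end of the pass,
  so that the last boundary of a pass is the first one of the next.\<close>

definition time :: "nat \<Rightarrow> nat \<Rightarrow> nat" where "time r b = r * t + min (b * n) t"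

text \<open>The state between two passes is recorded twice, at \<open>(r, K)\<close> and
  \<open>(Suc r, 0)\<close>. Restriction to a finite index set makes the transcripts countable as
  elements of a finite function space.\<close>

definition transcript :: "'x list \<Rightarrow> nat \<times> nat \<Rightarrow> bool list" where
  "transcript xs = (\<lambda>(r, b)\<in>{..<l} \<times> {..K}. mem_state A (passes l xs) (time r b))"

text \<open>Every pass reads the same block \<open>b\<close>, so all \<open>l\<close> passes impose
  their conditions on one word.\<close>

definition rect :: "nat \<Rightarrow> (nat \<times> nat \<Rightarrow> bool list) \<Rightarrow> 'x list set" where
  "rect b p = {ys \<in> words X (len b). \<forall>r<l. run A (time r b) (p (r, b)) ys = p (r, Suc b)}"

lemma block_in: "xs \<in> words X t \<Longrightarrow> block b xs \<in> words X (len b)"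
  using set_take_subset set_drop_subset by (fastforce simp: words_def block_def len_def)

lemma time_Suc_block: "time r (Suc b) = time r b + len b"
  by (auto simp: time_def len_def min_def)

lemma time_last: "time r K = time (Suc r) 0"
  using blocks by (simp add: time_def)

lemma mem_state_time_Suc:
  assumes xs: "xs \<in> words X t" and r: "r < l"
  shows "mem_state A (passes l xs) (time r (Suc b)) =
    run A (time r b) (mem_state A (passes l xs) (time r b)) (block b xs)"
proof -
  have len: "length xs = t" using xs by (simp add: words_def)
  have lb: "length (block b xs) = len b" by (simp add: block_def len_def len)
  have "take (len b) (drop (r * length xs + min (b * n) t) (passes l xs)) =
      take (len b) (drop (min (b * n) t) xs)"
    using r by (intro take_drop_passes) (auto simp: len len_def)
  also have "\<dots> = block b xs"
    by (cases "b * n \<le> t") (auto simp: block_def len_def len min_def)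
  finally have "take (length (block b xs)) (drop (time r b) (passes l xs)) = block b xs"
    by (simp add: lb time_def len)
  from mem_state_run[OF this] show ?thesis
    by (simp add: lb time_Suc_block)
qed

lemma transcript_apply:
  "r < l \<Longrightarrow> b \<le> K \<Longrightarrow> transcript xs (r, b) = mem_state A (passes l xs) (time r b)"
  by (simp add: transcript_def)

text \<open>Blocks consistent with \<open>p\<close> determine the states by induction along each
  pass, then over the passes. Being a transcript itself, \<open>p\<close> has the correct initial
  state and satisfies \<open>p (r, K) = p (Suc r, 0)\<close>.\<close>

lemma transcript_fibre:
  assumes xs: "xs \<in> words X t" and p: "p \<in> transcript ` words X t"
  shows "transcript xs = p \<longleftrightarrow> (\<forall>b<K. block b xs \<in> rect b p)"
proof
  assume "transcript xs = p"
  then show "\<forall>b<K. block b xs \<in> rect b p"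
    using block_in[OF xs] mem_state_time_Suc[OF xs] by (auto simp: rect_def transcript_apply)
next
  assume rect: "\<forall>b<K. block b xs \<in> rect b p"
  obtain zs where zs: "zs \<in> words X t" "p = transcript zs" using p by auto
  have step: "mem_state A (passes l xs) (time r b) = p (r, b)"
    if "mem_state A (passes l xs) (time r 0) = p (r, 0)" "r < l" "b \<le> K" for r b
    using that(3)
  proof (induction b)
    case (Suc b)
    then have "block b xs \<in> rect b p" "mem_state A (passes l xs) (time r b) = p (r, b)"
      using rect by auto
    then show ?case
      using that(2) by (simp add: mem_state_time_Suc[OF xs that(2)] rect_def)
  qed (use that in simp)
  have start: "mem_state A (passes l xs) (time r 0) = p (r, 0)" if "r < l" for r
    using that
  proof (induction r)
    case 0
    then show ?case by (simp add: zs transcript_apply time_def)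
  next
    case (Suc r)
    then have "mem_state A (passes l xs) (time r K) = p (r, K)"
      using step[of r K] by simp
    then show ?case
      using Suc.prems by (simp add: zs transcript_apply time_last)
  qed
  show "transcript xs = p"
  proof
    fix q :: "nat \<times> nat"
    obtain r b where q: "q = (r, b)" by (cases q)
    show "transcript xs q = p q"
    proof (cases "q \<in> {..<l} \<times> {..K}")
      case True
      then show ?thesis
        using step[OF start, of r b] by (simp add: q transcript_apply)
    qed (simp add: zs transcript_def)
  qed
qed

lemma mem_state_in:
  "j \<le> t * l \<Longrightarrow> mem_state A zs j \<in> mem_states s"
proof (induction j)
  case (Suc j)
  then have "upd A j (zs ! j) \<in> mem_states s \<rightarrow> mem_states s"
    using alg by (auto simp only: is_mem_alg_def)
  then show ?case using Suc by (auto dest: funcset_mem)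
qed (use alg in \<open>simp add: is_mem_alg_def\<close>)

lemma transcript_in:
  assumes "r < l" "b \<le> K"
  shows "transcript xs (r, b) \<in> mem_states s"
proof -
  have "time r b \<le> Suc r * t" by (simp add: time_def)
  also have "\<dots> \<le> l * t" using assms(1) by (intro mult_right_mono) auto
  also have "\<dots> = t * l" by (rule mult.commute)
  finally show ?thesis using assms by (simp add: transcript_apply mem_state_in)
qed

lemma card_transcripts: "card (transcript ` words X t) \<le> 2 ^ (s * (l * Suc K))"
proof -
  have "transcript ` words X t \<subseteq> ({..<l} \<times> {..K}) \<rightarrow>\<^sub>E mem_states s"
  proof clarify
    fix xs
    have "transcript xs \<in> extensional ({..<l} \<times> {..K})" by (simp add: transcript_def)
    then show "transcript xs \<in> ({..<l} \<times> {..K}) \<rightarrow>\<^sub>E mem_states s"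
      using transcript_in by (auto simp: PiE_iff)
  qed
  then have "card (transcript ` words X t) \<le> card (({..<l} \<times> {..K}) \<rightarrow>\<^sub>E mem_states s)"
    by (intro card_mono finite_PiE) (auto simp: finite_mem_states)
  also have "\<dots> = 2 ^ (s * (l * Suc K))"
    by (simp add: card_PiE card_mem_states power_mult)
  finally show ?thesis .
qed

text \<open>The side at block \<open>b\<close> depends only on the states at its two ends in each of
  the \<open>l\<close> passes.\<close>

lemma card_rects:
  assumes "b < K"
  shows "card (rect b ` transcript ` words X t) \<le> 4 ^ (s * l)"
proof -
  define F where "F h = {ys \<in> words X (len b). \<forall>r<l. run A (time r b) (fst (h r)) ys = snd (h r)}"
    for h :: "nat \<Rightarrow> bool list \<times> bool list"
  let ?P = "{..<l} \<rightarrow>\<^sub>E mem_states s \<times> mem_states s"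
  have fin: "finite ?P" by (intro finite_PiE) (auto simp: finite_mem_states)
  have "rect b ` transcript ` words X t \<subseteq> F ` ?P"
  proof clarify
    fix xs
    let ?p = "transcript xs"
    let ?h = "\<lambda>r\<in>{..<l}. (?p (r, b), ?p (r, Suc b))"
    have "rect b ?p = F ?h" by (auto simp: rect_def F_def)
    moreover have "?h \<in> ?P" using assms by (auto intro!: transcript_in)
    ultimately show "rect b ?p \<in> F ` ?P" by blast
  qed
  then have "card (rect b ` transcript ` words X t) \<le> card ?P"
    using fin by (meson card_image_le card_mono finite_imageI le_trans)
  also have "\<dots> = 4 ^ (s * l)"
    by (simp add: card_PiE card_cartesian_product card_mem_states power_mult
        power_mult_distrib[symmetric])
  finally show ?thesis .
qed

text \<open>The last recorded state is the final memory.\<close>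

lemma alg_output_transcript:
  assumes "xs \<in> words X t"
  shows "alg_output l A xs = out A (transcript xs (l - 1, K))"
proof -
  have "time (l - 1) K = t * l"
    using l_pos by (simp add: time_last) (simp add: time_def mult.commute)
  then show ?thesis
    using assms l_pos by (simp add: alg_output_def transcript_apply words_def)
qed

sublocale rectangle_map "words X t" K block "\<lambda>b. words X (len b)" transcript rect
proof
  show "(\<Sum>xs\<in>words X t. \<Prod>b<K. g b (block b xs)) = (\<Prod>b<K. \<Sum>ys\<in>words X (len b). g b ys)"
    for g :: "nat \<Rightarrow> 'x list \<Rightarrow> real"
    unfolding block_def len_def by (rule sum_words_blocks[OF blocks])
  show "transcript xs = p \<longleftrightarrow> (\<forall>b<K. block b xs \<in> rect b p)"
    if "xs \<in> words X t" "p \<in> transcript ` words X t" for xs p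
    using that by (rule transcript_fibre)
qed (use fin_X words_nonempty[OF ne_X] in \<open>auto simp: rect_def finite_words block_in\<close>)

end

section \<open>Identification\<close>

text \<open>Donsker--Varadhan with the test function that is \<open>ln 2\<close> off the event \<open>E\<close> and \<open>0\<close> on it.\<close>

lemma sum_minus_ln_ge:
  fixes G :: "'w \<Rightarrow> real"
  assumes "finite \<Omega>" "E \<subseteq> \<Omega>" and pos: "\<And>x. x \<in> \<Omega> \<Longrightarrow> 0 < G x"
    and le: "(\<Sum>x\<in>\<Omega>. G x * (if x \<in> E then 1 else 2)) \<le> 4 / 3 * real (card \<Omega>)"
  shows "ln 2 * (real (card \<Omega>) - real (card E)) - ln (4 / 3) * real (card \<Omega>) \<le> (\<Sum>x\<in>\<Omega>. - ln (G x))"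
proof -
  define c where "c x = (if x \<in> E then 1 else 2 :: real)" for x
  have "(\<Sum>x\<in>\<Omega>. ln (c x)) = (\<Sum>x\<in>\<Omega> - E. ln 2)"
    by (rule sum.mono_neutral_cong_right) (use assms(1) in \<open>auto simp: c_def\<close>)
  also have "\<dots> = ln 2 * (real (card \<Omega>) - real (card E))"
    using assms(1,2) finite_subset[OF assms(2,1)] card_mono[OF assms(1,2)]
    by (simp add: card_Diff_subset of_nat_diff)
  finally have sum_c: "(\<Sum>x\<in>\<Omega>. ln (c x)) = ln 2 * (real (card \<Omega>) - real (card E))" .
  \<comment> \<open>This is \<open>ln y \<le> y - 1\<close> at
    \<open>y = 3 / 4 * (G x * c x)\<close>; the factor \<open>3 / 4\<close> makes the sum of
    \<open>y - 1\<close> nonpositive.\<close>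
  have "ln (c x) - ln (4 / 3) - (3 / 4 * (G x * c x) - 1) \<le> - ln (G x)" if x: "x \<in> \<Omega>" for x
  proof -
    have cx: "0 < c x" by (simp add: c_def)
    have "ln (3 / 4 * (G x * c x)) \<le> 3 / 4 * (G x * c x) - 1"
      using pos[OF x] cx by (intro ln_le_minus_one) auto
    moreover have "ln (3 / 4 * (G x * c x)) = - ln (4 / 3) + (ln (G x) + ln (c x))"
      using pos[OF x] cx by (simp add: ln_mult ln_div)
    ultimately show ?thesis by linarith
  qed
  then have "(\<Sum>x\<in>\<Omega>. ln (c x) - ln (4 / 3) - (3 / 4 * (G x * c x) - 1)) \<le> (\<Sum>x\<in>\<Omega>. - ln (G x))"
    by (rule sum_mono)
  moreover have "(\<Sum>x\<in>\<Omega>. ln (c x) - ln (4 / 3) - (3 / 4 * (G x * c x) - 1)) =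
      (\<Sum>x\<in>\<Omega>. ln (c x)) - ln (4 / 3) * real (card \<Omega>)
        - (3 / 4 * (\<Sum>x\<in>\<Omega>. G x * c x) - real (card \<Omega>))"
    by (simp add: sum_subtractf sum_distrib_left)
  moreover have "(\<Sum>x\<in>\<Omega>. G x * c x) \<le> 4 / 3 * real (card \<Omega>)"
    using le by (simp add: c_def)
  ultimately show ?thesis using sum_c by linarith
qed

text \<open>The events \<open>g x = f i\<close> are disjoint, so together they lose at most
  \<open>ln 2 * real (card \<Omega>)\<close>, while every index gains
  \<open>ln (3 / 2) \<ge> 1 / 3\<close> per point. \<open>G\<close> is general because it is taken
  both as the full likelihood ratio and as its average over fibres.\<close>

lemma sum_divergence_ge:
  fixes G :: "'i \<Rightarrow> 'w \<Rightarrow> real" and g :: "'w \<Rightarrow> 'o"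
  assumes "finite \<Omega>" "finite U" "inj_on f U"
    and pos: "\<And>i x. i \<in> U \<Longrightarrow> x \<in> \<Omega> \<Longrightarrow> 0 < G i x"
    and le: "\<And>i. i \<in> U \<Longrightarrow>
      (\<Sum>x\<in>\<Omega>. G i x * (if g x = f i then 1 else 2)) \<le> 4 / 3 * real (card \<Omega>)"
  shows "real (card \<Omega>) * (real (card U) / 3 - 1) \<le> (\<Sum>i\<in>U. \<Sum>x\<in>\<Omega>. - ln (G i x))"
proof -
  define E where "E i = {x \<in> \<Omega>. g x = f i}" for i
  define N where "N = real (card \<Omega>)"
  define m where "m = real (card U)"
  have one: "ln 2 * (N - real (card (E i))) - ln (4 / 3) * N \<le> (\<Sum>x\<in>\<Omega>. - ln (G i x))" if i: "i \<in> U" for i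
    unfolding N_def
  proof (rule sum_minus_ln_ge[OF assms(1)])
    have "(\<Sum>x\<in>\<Omega>. G i x * (if x \<in> E i then 1 else 2)) = (\<Sum>x\<in>\<Omega>. G i x * (if g x = f i then 1 else 2))"
      by (intro sum.cong refl) (simp add: E_def)
    then show "(\<Sum>x\<in>\<Omega>. G i x * (if x \<in> E i then 1 else 2)) \<le> 4 / 3 * real (card \<Omega>)"
      using le[OF i] by simp
  qed (use pos[OF i] in \<open>auto simp: E_def\<close>)
  have "(\<Sum>i\<in>U. card (E i)) = card (\<Union>i\<in>U. E i)"
    using assms(1-3) by (subst card_UN_disjoint) (auto simp: E_def inj_on_def)
  also have "\<dots> \<le> card \<Omega>"
    using assms(1) by (intro card_mono) (auto simp: E_def)
  finally have E: "(\<Sum>i\<in>U. real (card (E i))) \<le> N"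
    by (simp add: N_def flip: of_nat_sum)
  have "ln (3 / 2 :: real) = ln 2 - ln (4 / 3)"
    using ln_div[of "2::real" "4 / 3"] by simp
  moreover have "1 / 3 \<le> ln (3 / 2 :: real)"
    using ln_le_minus_one[of "2 / 3 :: real"] ln_div[of "2::real" 3] ln_div[of "3::real" 2]
    by simp
  ultimately have l: "1 / 3 \<le> ln 2 - ln (4 / 3 :: real)" by simp
  have ln2: "0 \<le> ln (2 :: real)" "ln (2 :: real) \<le> 1" using ln_le_minus_one[of "2::real"] by auto
  have "N * (m / 3 - 1) = m * N * (1 / 3) - 1 * N" by (simp add: algebra_simps)
  also have "\<dots> \<le> m * N * (ln 2 - ln (4 / 3)) - ln 2 * N"
    using l ln2 by (intro diff_mono mult_left_mono mult_right_mono) (auto simp: N_def m_def)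
  also have "\<dots> \<le> m * N * (ln 2 - ln (4 / 3)) - ln 2 * (\<Sum>i\<in>U. real (card (E i)))"
    using E ln2 by (intro diff_left_mono mult_left_mono) auto
  also have "\<dots> = (\<Sum>i\<in>U. ln 2 * (N - real (card (E i))) - ln (4 / 3) * N)"
    by (simp add: sum_subtractf sum.distrib sum_distrib_left m_def algebra_simps)
  also have "\<dots> \<le> (\<Sum>i\<in>U. \<Sum>x\<in>\<Omega>. - ln (G i x))"
    by (intro sum_mono one)
  finally show ?thesis by (simp add: N_def m_def)
qed

text \<open>Makes the contribution of small sides negligible for blocks of length
  \<open>m ^ 3\<close>: there \<open>n / m\<close> is \<open>m ^ 2\<close>, and the number of sides
  is at most \<open>4 ^ m\<close>.\<close>

lemma pow4_times_4_pow_le_exp: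
  fixes m :: nat
  assumes "6 \<le> m"
  shows "real m ^ 4 * 4 ^ m \<le> exp (real m ^ 2)"
proof -
  have "real m ^ 4 \<le> exp (real m) ^ 4"
    using exp_ge_add_one_self[of "real m"] by (intro power_mono) linarith+
  also have "\<dots> = exp (4 * real m)" by (simp add: exp_of_nat_mult[symmetric])
  finally have a: "real m ^ 4 \<le> exp (4 * real m)" .
  have "(2 :: real) ^ 2 \<le> exp 1 ^ 2"
    using exp_ge_add_one_self[of "1::real"] by (intro power_mono) auto
  then have "(4 :: real) ^ m \<le> exp 2 ^ m"
    by (intro power_mono) (auto simp: exp_of_nat_mult[symmetric])
  also have "\<dots> = exp (2 * real m)" by (simp add: exp_of_nat_mult[symmetric] mult.commute)
  finally have "real m ^ 4 * 4 ^ m \<le> exp (4 * real m) * exp (2 * real m)"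
    using a by (intro mult_mono) auto
  also have "\<dots> = exp (6 * real m)" by (simp add: exp_add[symmetric])
  also have "\<dots> \<le> exp (real m ^ 2)"
    using assms by (simp add: power2_eq_square)
  finally show ?thesis .
qed

section \<open>The lower bound for orthogonal signs\<close>

context orthogonal_signs
begin

lemma lik_pos:
  assumes "i \<in> U" "0 \<le> \<rho>" "\<rho> < 1" "xs \<in> words X n"
  shows "0 < lik \<rho> (\<phi> i) xs"
proof -
  have "0 < (1 - \<rho>) ^ n" using assms by simp
  also have "\<dots> \<le> lik \<rho> (\<phi> i) xs"
    using assms signs[OF assms(1)] by (intro lik_ge[of X]) auto
  finally show ?thesis .
qed

text \<open>Relative entropy is additive over the letters, and one letter costs at most
  \<open>2 * \<rho>\<^sup>2\<close>. This bounds what the samples reveal whatever the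
  memory.\<close>

lemma sum_minus_ln_lik_le:
  assumes i: "i \<in> U" and \<rho>: "0 \<le> \<rho>" "\<rho> \<le> 1 / 2"
  shows "(\<Sum>xs\<in>words X n. - ln (lik \<rho> (\<phi> i) xs)) \<le> real (card (words X n)) * (2 * real n * \<rho>\<^sup>2)"
proof (induction n)
  case (Suc n)
  have one: "(\<Sum>x\<in>X. - ln (1 + \<rho> * \<phi> i x)) \<le> real (card X) * (2 * \<rho>\<^sup>2)"
  proof -
    have "(\<Sum>x\<in>X. - ln (1 + \<rho> * \<phi> i x)) \<le> (\<Sum>x\<in>X. - (\<rho> * \<phi> i x) + 2 * \<rho>\<^sup>2)"
    proof (intro sum_mono)
      fix x assume x: "x \<in> X"
      have "- ln (1 + \<rho> * \<phi> i x) \<le> - (\<rho> * \<phi> i x) + 2 * (\<rho> * \<phi> i x)\<^sup>2"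
        using signs[OF i x] \<rho> by (intro minus_ln_le_quadratic) auto
      also have "(\<rho> * \<phi> i x)\<^sup>2 = \<rho>\<^sup>2" using signs[OF i x] by auto
      finally show "- ln (1 + \<rho> * \<phi> i x) \<le> - (\<rho> * \<phi> i x) + 2 * \<rho>\<^sup>2" .
    qed
    also have "\<dots> = - \<rho> * (\<Sum>x\<in>X. \<phi> i x) + real (card X) * (2 * \<rho>\<^sup>2)"
      by (simp add: sum_subtractf sum_negf sum_distrib_left)
    finally show ?thesis using balanced[OF i] by simp
  qed
  have "(\<Sum>xs\<in>words X (Suc n). - ln (lik \<rho> (\<phi> i) xs)) =
      (\<Sum>x\<in>X. \<Sum>xs\<in>words X n. - ln (1 + \<rho> * \<phi> i x) + - ln (lik \<rho> (\<phi> i) xs))"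
    unfolding sum_words_Suc
  proof (intro sum.cong refl)
    fix x xs assume x: "x \<in> X" and xs: "xs \<in> words X n"
    have "0 < 1 + \<rho> * \<phi> i x" using signs[OF i x] \<rho> by auto
    then show "- ln (lik \<rho> (\<phi> i) (x # xs)) = - ln (1 + \<rho> * \<phi> i x) + - ln (lik \<rho> (\<phi> i) xs)"
      using lik_pos[OF i _ _ xs, of \<rho>] \<rho> by (simp add: ln_mult)
  qed
  also have "\<dots> = real (card (words X n)) * (\<Sum>x\<in>X. - ln (1 + \<rho> * \<phi> i x))
      + real (card X) * (\<Sum>xs\<in>words X n. - ln (lik \<rho> (\<phi> i) xs))"
    by (simp only: sum.distrib sum_constant sum_distrib_left of_nat_id)
  also have "\<dots> \<le> real (card (words X n)) * (real (card X) * (2 * \<rho>\<^sup>2))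
      + real (card X) * (real (card (words X n)) * (2 * real n * \<rho>\<^sup>2))"
    using one Suc.IH by (intro add_mono mult_left_mono) auto
  also have "\<dots> = real (card (words X (Suc n))) * (2 * real (Suc n) * \<rho>\<^sup>2)"
    using finite_X by (simp add: card_words algebra_simps)
  finally show ?case .
qed (simp)

text \<open>\<open>correct\<close> is success with probability at least 2/3, written through the
  density \<open>lik\<close>. If the bound fails, the full data give a lower bound on
  \<open>t\<close>, hence an upper bound on \<open>s * l\<close>, and the transcript then gives a
  contradiction.\<close>

lemma identification_lower_bound:
  fixes A :: "('a, 'o) mem_alg" and f :: "'i \<Rightarrow> 'o"
  defines "m \<equiv> card U"
  assumes alg: "is_mem_alg t s l A" and f: "inj_on f U"
    and correct: "\<And>i. i \<in> U \<Longrightarrow> 2 / 3 * real (card (words X t)) \<le>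
      (\<Sum>xs\<in>{xs \<in> words X t. alg_output l A xs = f i}. lik \<rho> (\<phi> i) xs)"
    and m: "30 \<le> m" and \<rho>: "0 < \<rho>" "real m ^ 3 * \<rho> \<le> 1 / 1000"
    and s: "1 \<le> s" and l: "1 \<le> l"
  shows "real m / (1000 * \<rho>\<^sup>2) \<le> real (t * s * l)"
proof (rule ccontr)
  assume "\<not> ?thesis"
  then have tsl: "\<rho>\<^sup>2 * real (t * s * l) \<le> real m / 1000"
    using \<rho> by (simp add: field_simps)
  define N where "N = real (card (words X t))"
  have N: "0 < N"
    using finite_words[OF finite_X] words_nonempty[OF X_nonempty] by (simp add: N_def card_gt_0_iff)
  have m1: "1 \<le> real m ^ 3" "real m \<le> real m ^ 3"
    using m by (auto intro: self_le_power)
  have \<rho>1: "\<rho> \<le> 1 / 1000" "real m * \<rho> \<le> 1 / 1000"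
  proof -
    have "1 * \<rho> \<le> real m ^ 3 * \<rho>" "real m * \<rho> \<le> real m ^ 3 * \<rho>"
      using m1 \<rho> by (intro mult_right_mono; simp)+
    then show "\<rho> \<le> 1 / 1000" "real m * \<rho> \<le> 1 / 1000" using \<rho> by linarith+
  qed
  \<comment> \<open>Wrong answers count twice: total mass 2 minus a success mass of at least
    2/3.\<close>
  have cost: "(\<Sum>xs\<in>words X t. lik \<rho> (\<phi> i) xs * (if alg_output l A xs = f i then 1 else 2)) \<le> 4 / 3 * N"
    if i: "i \<in> U" for i
  proof -
    let ?L = "lik \<rho> (\<phi> i)"
    have "(\<Sum>xs\<in>words X t. ?L xs * (if alg_output l A xs = f i then 1 else 2)) =
        (\<Sum>xs\<in>words X t. 2 * ?L xs - (if alg_output l A xs = f i then ?L xs else 0))"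
      by (intro sum.cong refl) auto
    also have "\<dots> = 2 * (\<Sum>xs\<in>words X t. ?L xs) -
        (\<Sum>xs\<in>{xs \<in> words X t. alg_output l A xs = f i}. ?L xs)"
      using finite_words[OF finite_X] by (simp add: sum_subtractf sum_distrib_left sum.inter_filter)
    also have "(\<Sum>xs\<in>words X t. ?L xs) = N"
      unfolding N_def using finite_X X_nonempty signs[OF i] balanced[OF i] by (intro sum_words_lik) auto
    finally show ?thesis using correct[OF i] by (simp add: N_def)
  qed

  \<comment> \<open>Here the full data play the transcript; the result is \<open>t\<close> of order
    at least \<open>1 / \<rho>\<^sup>2\<close>.\<close>
  have "N * (real m / 3 - 1) \<le> (\<Sum>i\<in>U. \<Sum>xs\<in>words X t. - ln (lik \<rho> (\<phi> i) xs))"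
    unfolding N_def m_def
  proof (rule sum_divergence_ge[OF finite_words[OF finite_X] finite_U f])
    show "0 < lik \<rho> (\<phi> i) xs" if "i \<in> U" "xs \<in> words X t" for i xs
      using lik_pos[OF that(1) _ _ that(2)] \<rho> \<rho>1 by auto
    show "(\<Sum>xs\<in>words X t. lik \<rho> (\<phi> i) xs * (if alg_output l A xs = f i then 1 else 2))
      \<le> 4 / 3 * real (card (words X t))" if "i \<in> U" for i
      using cost[OF that] by (simp add: N_def)
  qed
  also have "\<dots> \<le> (\<Sum>i\<in>U. N * (2 * real t * \<rho>\<^sup>2))"
    unfolding N_def using \<rho> \<rho>1 by (intro sum_mono sum_minus_ln_lik_le) auto
  also have "\<dots> = N * (real m * (2 * (\<rho>\<^sup>2 * real t)))" by (simp add: m_def)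
  finally have "real m / 3 - 1 \<le> real m * (2 * (\<rho>\<^sup>2 * real t))" using N by simp
  moreover have "real m * (3 / 10) \<le> real m / 3 - 1" using m by simp
  ultimately have "real m * (3 / 10) \<le> real m * (2 * (\<rho>\<^sup>2 * real t))" by linarith
  then have t: "3 / 20 \<le> \<rho>\<^sup>2 * real t" using m by simp

  have sl: "s * l \<le> m"
  proof -
    have "3 / 20 * real (s * l) \<le> \<rho>\<^sup>2 * real t * real (s * l)"
      using t by (intro mult_right_mono) auto
    also have "\<dots> \<le> real m / 1000" using tsl by (simp add: mult.assoc)
    finally have "real (s * l) \<le> real m" using m by linarith
    then show ?thesis by (simp only: of_nat_le_iff)
  qed
  have t_le: "\<rho>\<^sup>2 * real t \<le> real m / 1000"
  proof -
    have "1 \<le> s * l" using s l by simp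
    then have "real t * 1 \<le> real t * real (s * l)" by (intro mult_left_mono) linarith+
    then have "\<rho>\<^sup>2 * real t \<le> \<rho>\<^sup>2 * real (t * s * l)"
      by (intro mult_left_mono) (auto simp: mult.assoc)
    then show ?thesis using tsl by simp
  qed

  \<comment> \<open>Long enough for \<open>exp (- n / m)\<close> to beat \<open>4 ^ (s * l)\<close>
    when \<open>s * l \<le> m\<close>, and short enough for \<open>n * \<rho>\<close> to be
    small.\<close>
  define n where "n = m ^ 3"
  define K where "K = Suc (t div n)"
  have n: "0 < n" using m by (simp add: n_def)
  have n\<rho>: "real n * \<rho> \<le> 1 / 1000" using \<rho> by (simp add: n_def)
  have tK: "t \<le> K * n"
    using dividend_less_div_times[OF n, of t] by (simp add: K_def)
  \<comment> \<open>A block is no longer than the data, so rounding \<open>t\<close> up to whole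
    blocks at most doubles it.\<close>
  have nt: "real n \<le> real t"
  proof -
    have "\<rho>\<^sup>2 * real n = (real n * \<rho>) * \<rho>" by (simp add: power2_eq_square)
    also have "\<dots> \<le> 1 / 1000 * (1 / 1000)" using n\<rho> \<rho>1 \<rho> by (intro mult_mono) auto
    also have "\<dots> \<le> \<rho>\<^sup>2 * real t" using t by simp
    finally show ?thesis using \<rho> by simp
  qed
  have Kn: "real K * real n \<le> 2 * real t"
  proof -
    have "K * n \<le> t + n" by (simp add: K_def)
    then have "real (K * n) \<le> real (t + n)" by (rule of_nat_mono)
    then show ?thesis using nt by simp
  qed

  interpret B: blocked_algorithm X t s l n K A
    using finite_X X_nonempty alg l tK by unfold_locales auto
  interpret P: block_protocol X U \<phi> "words X t" K B.block B.len B.transcript B.rect n \<rho> "4 ^ (s * l)"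
  proof unfold_locales
    show "real (card (B.rect b ` B.transcript ` words X t)) \<le> 4 ^ (s * l)" if "b < K" for b
      using B.card_rects[OF that] by (simp flip: of_nat_le_iff)
  qed (use n n\<rho> \<rho> in \<open>auto simp: B.len_def\<close>)

  have whole: "P.lik_whole i xs = lik \<rho> (\<phi> i) xs" if "xs \<in> words X t" for i xs
    using that lik_blocks[of xs K n \<rho> "\<phi> i"] tK by (simp add: P.lik_whole_def B.block_def words_def)
  have "N * (real m / 3 - 1) \<le>
      (\<Sum>i\<in>U. \<Sum>xs\<in>words X t. - ln (avg (P.lik_whole i) (B.fibre (B.transcript xs))))"
    unfolding N_def m_def
  proof (rule sum_divergence_ge[OF finite_words[OF finite_X] finite_U f])
    fix i assume i: "i \<in> U"
    show "0 < avg (P.lik_whole i) (B.fibre (B.transcript xs))" if xs: "xs \<in> words X t" for xs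
    proof -
      have "0 < (\<Sum>ys\<in>B.fibre (B.transcript xs). P.lik_whole i ys)"
        using xs lik_pos[OF i, of \<rho>] \<rho> \<rho>1
        by (intro sum_pos B.finite_fibre) (auto simp: B.fibre_def whole)
      then show ?thesis
        using B.card_fibre_pos[of "B.transcript xs"] xs by (simp add: avg_def)
    qed
    \<comment> \<open>The weight is read off the transcript, so \<open>sum_avg_fibre\<close> reduces
      the claim to \<open>cost\<close>.\<close>
    let ?c = "\<lambda>p. if out A (p (l - 1, K)) = f i then 1 else 2 :: real"
    have "(\<Sum>xs\<in>words X t. avg (P.lik_whole i) (B.fibre (B.transcript xs)) *
        (if alg_output l A xs = f i then 1 else 2)) =
        (\<Sum>xs\<in>words X t. avg (P.lik_whole i) (B.fibre (B.transcript xs)) * ?c (B.transcript xs))"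
      by (intro sum.cong refl) (simp add: B.alg_output_transcript)
    also have "\<dots> = (\<Sum>xs\<in>words X t. P.lik_whole i xs * ?c (B.transcript xs))"
      by (rule B.sum_avg_fibre)
    also have "\<dots> = (\<Sum>xs\<in>words X t. lik \<rho> (\<phi> i) xs * (if alg_output l A xs = f i then 1 else 2))"
      by (intro sum.cong refl) (simp add: B.alg_output_transcript whole)
    also have "\<dots> \<le> 4 / 3 * real (card (words X t))"
      using cost[OF i] by (simp add: N_def)
    finally show "(\<Sum>xs\<in>words X t. avg (P.lik_whole i) (B.fibre (B.transcript xs)) *
        (if alg_output l A xs = f i then 1 else 2)) \<le> 4 / 3 * real (card (words X t))" .
  qed
  also have "\<dots> \<le> N * (16 * real n * \<rho>\<^sup>2 * ln (real (card (B.transcript ` words X t))) +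
      real K * (4 * \<rho>\<^sup>2 * real m * (real n)\<^sup>2 * 4 ^ (s * l) * exp (- real n / real m)
        + 4 * real m * (real n * \<rho>\<^sup>2)\<^sup>2))"
    unfolding N_def m_def by (rule P.divergence_le)
  finally have main: "real m / 3 - 1 \<le> 16 * real n * \<rho>\<^sup>2 * ln (real (card (B.transcript ` words X t))) +
      real K * (4 * \<rho>\<^sup>2 * real m * (real n)\<^sup>2 * 4 ^ (s * l) * exp (- real n / real m)
        + 4 * real m * (real n * \<rho>\<^sup>2)\<^sup>2)"
    using N by simp

  \<comment> \<open>The main term: a transcript has \<open>s * (l * Suc K)\<close> bits, with
    \<open>Suc K \<le> 2 * K\<close> and \<open>K * n \<le> 2 * t\<close>.\<close>
  have "16 * real n * \<rho>\<^sup>2 * ln (real (card (B.transcript ` words X t))) \<le> 64 * (\<rho>\<^sup>2 * real (t * s * l))"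
  proof -
    have c0: "0 < card (B.transcript ` words X t)"
      using finite_words[OF finite_X] words_nonempty[OF X_nonempty] by (simp add: card_gt_0_iff)
    have "real (card (B.transcript ` words X t)) \<le> 2 ^ (s * (l * Suc K))"
      using B.card_transcripts by (simp flip: of_nat_le_iff)
    then have "ln (real (card (B.transcript ` words X t))) \<le> ln (2 ^ (s * (l * Suc K)))"
      using c0 by (intro ln_mono) auto
    also have "\<dots> = real (s * (l * Suc K)) * ln 2" by (simp add: ln_realpow)
    also have "\<dots> \<le> real (s * (l * Suc K)) * 1"
      using ln_le_minus_one[of "2::real"] by (intro mult_left_mono) auto
    also have "\<dots> = real (s * l) * real (Suc K)"
      by (simp only: of_nat_mult mult.assoc mult_1_right)
    also have "\<dots> \<le> real (s * l) * (2 * real K)"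
      by (intro mult_left_mono) (auto simp: K_def)
    finally have "16 * real n * \<rho>\<^sup>2 * ln (real (card (B.transcript ` words X t))) \<le>
        16 * real n * \<rho>\<^sup>2 * (real (s * l) * (2 * real K))"
      by (intro mult_left_mono) auto
    also have "\<dots> = 32 * \<rho>\<^sup>2 * real (s * l) * (real K * real n)" by (simp add: mult_ac)
    also have "\<dots> \<le> 32 * \<rho>\<^sup>2 * real (s * l) * (2 * real t)" using Kn by (intro mult_left_mono) auto
    also have "\<dots> = 64 * (\<rho>\<^sup>2 * real (t * s * l))" by (simp add: mult_ac)
    finally show ?thesis .
  qed
  \<comment> \<open>The contribution of the small sides.\<close>
  moreover have "real K * (4 * \<rho>\<^sup>2 * real m * (real n)\<^sup>2 * 4 ^ (s * l) * exp (- real n / real m)) \<le>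
      8 * (\<rho>\<^sup>2 * real t)"
  proof -
    have nm: "real n / real m = real m ^ 2" using m by (simp add: n_def power2_eq_square power3_eq_cube)
    have "real m * real n * 4 ^ (s * l) * exp (- real n / real m) =
        real m ^ 4 * 4 ^ (s * l) * exp (- (real m ^ 2))"
      by (simp add: nm) (simp add: n_def power3_eq_cube power4_eq_xxxx)
    also have "\<dots> \<le> real m ^ 4 * 4 ^ m * exp (- (real m ^ 2))"
      using sl by (intro mult_right_mono mult_left_mono power_increasing) auto
    also have "\<dots> \<le> exp (real m ^ 2) * exp (- (real m ^ 2))"
      using m by (intro mult_right_mono pow4_times_4_pow_le_exp) auto
    also have "\<dots> = 1" by (simp add: exp_minus)
    finally have small: "real m * real n * 4 ^ (s * l) * exp (- real n / real m) \<le> 1" .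
    have "real K * (4 * \<rho>\<^sup>2 * real m * (real n)\<^sup>2 * 4 ^ (s * l) * exp (- real n / real m)) =
        4 * \<rho>\<^sup>2 * (real K * real n) * (real m * real n * 4 ^ (s * l) * exp (- real n / real m))"
      by (simp add: power2_eq_square mult_ac)
    also have "\<dots> \<le> 4 * \<rho>\<^sup>2 * (2 * real t) * 1"
      by (rule mult_mono[OF mult_left_mono[OF Kn] small]) auto
    finally show ?thesis by (simp add: mult_ac)
  qed
  \<comment> \<open>The contribution of the nonlinear remainder.\<close>
  moreover have "real K * (4 * real m * (real n * \<rho>\<^sup>2)\<^sup>2) \<le> 8 * (\<rho>\<^sup>2 * real t)"
  proof -
    have "real K * (4 * real m * (real n * \<rho>\<^sup>2)\<^sup>2) =
        4 * \<rho>\<^sup>2 * (real K * real n) * ((real m * \<rho>) * (real n * \<rho>))"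
      by (simp add: power2_eq_square mult_ac)
    also have "\<dots> \<le> 4 * \<rho>\<^sup>2 * (2 * real t) * ((1 / 1000) * (1 / 1000))"
      using \<rho> by (intro mult_mono[OF mult_left_mono[OF Kn] mult_mono[OF \<rho>1(2) n\<rho>]]) auto
    also have "\<dots> \<le> 4 * \<rho>\<^sup>2 * (2 * real t) * 1"
      by (intro mult_left_mono) auto
    finally show ?thesis by (simp add: mult_ac)
  qed
  ultimately have "real m / 3 - 1 \<le> 64 * (\<rho>\<^sup>2 * real (t * s * l)) + 16 * (\<rho>\<^sup>2 * real t)"
    using main unfolding distrib_left by linarith
  \<comment> \<open>The right side is at most \<open>80 * m / 1000\<close>, the left side at least
    \<open>3 * m / 10\<close>.\<close>
  then show False using tsl t_le m by simp
qed

end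

section \<open>Parities on the cube\<close>

lemma pmf_replicate_pmf: "pmf (replicate_pmf (length xs) p) xs = prod_list (map (pmf p) xs)"
proof (induction xs)
  case (Cons x xs)
  have "replicate_pmf (Suc n) p = map_pmf (\<lambda>(x, xs). x # xs) (pair_pmf p (replicate_pmf n p))" for n
    by (simp add: pair_pmf_def map_bind_pmf)
  moreover have "inj (\<lambda>(x :: 'a, xs). x # xs)" by (auto simp: inj_def)
  ultimately have "pmf (replicate_pmf (Suc (length xs)) p) (x # xs) =
      pmf (pair_pmf p (replicate_pmf (length xs) p)) (x, xs)"
    using pmf_map_inj'[of "\<lambda>(x, xs). x # xs" "pair_pmf p (replicate_pmf (length xs) p)" "(x, xs)"]
    by simp
  then show ?case using Cons.IH by (simp add: pmf_pair)
qed simp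

lemma prob_replicate_pmf:
  assumes "finite X" "set_pmf p \<subseteq> X"
  shows "measure_pmf.prob (replicate_pmf t p) S =
    (\<Sum>xs\<in>{xs \<in> words X t. xs \<in> S}. prod_list (map (pmf p) xs))"
proof -
  have "measure_pmf.prob (replicate_pmf t p) S =
      measure_pmf.prob (replicate_pmf t p) {xs \<in> words X t. xs \<in> S}"
    using assms(2)
    by (intro measure_pmf.finite_measure_eq_AE) (auto simp: AE_measure_pmf_iff set_replicate_pmf words_def)
  also have "\<dots> = (\<Sum>xs\<in>{xs \<in> words X t. xs \<in> S}. pmf (replicate_pmf t p) xs)"
    using finite_words[OF assms(1)] by (intro measure_measure_pmf_finite) auto
  also have "\<dots> = (\<Sum>xs\<in>{xs \<in> words X t. xs \<in> S}. prod_list (map (pmf p) xs))"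
    by (intro sum.cong refl) (auto simp: words_def pmf_replicate_pmf)
  finally show ?thesis .
qed

section \<open>Parities as orthogonal signs\<close>

lemma card_cube: "card (cube d) = 2 ^ d"
  by (simp add: cube_def card_PiE numeral_2_eq_2)

lemma cube_prod_signs:
  assumes "I \<subseteq> {1..d}" "x \<in> cube d"
  shows "(\<Prod>i\<in>I. x i) \<in> {-1, 1}"
proof (rule prod_signs)
  show "x i \<in> {-1, 1}" if "i \<in> I" for i
    using assms that unfolding cube_def by (meson PiE_mem subsetD)
qed

text \<open>The common indices cancel, since a parity squares to 1 on the cube.\<close>

lemma cube_prod_mult:
  assumes "I \<subseteq> {1..d}" "J \<subseteq> {1..d}" "x \<in> cube d"
  shows "(\<Prod>i\<in>I. x i) * (\<Prod>i\<in>J. x i) = (\<Prod>i\<in>(I - J) \<union> (J - I). x i)"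
proof -
  have fin: "finite I" "finite J" using assms finite_subset by blast+
  have "I \<inter> J \<subseteq> {1..d}" using assms by auto
  from cube_prod_signs[OF this assms(3)]
  have sq: "(\<Prod>i\<in>I \<inter> J. x i) * (\<Prod>i\<in>I \<inter> J. x i) = 1" by auto
  have "(\<Prod>i\<in>I. x i) = (\<Prod>i\<in>I - J. x i) * (\<Prod>i\<in>I \<inter> J. x i)"
    using fin by (subst prod.union_disjoint[symmetric]) (auto intro: prod.cong)
  moreover have "(\<Prod>i\<in>J. x i) = (\<Prod>i\<in>J - I. x i) * (\<Prod>i\<in>I \<inter> J. x i)"
    using fin by (subst prod.union_disjoint[symmetric]) (auto intro: prod.cong)
  moreover have "(\<Prod>i\<in>(I - J) \<union> (J - I). x i) = (\<Prod>i\<in>I - J. x i) * (\<Prod>i\<in>J - I. x i)"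
    using fin by (intro prod.union_disjoint) auto
  ultimately show ?thesis using sq by (simp add: algebra_simps)
qed

text \<open>The product of two distinct parities is the parity of their nonempty symmetric
  difference, which has mean zero.\<close>

lemma orthogonal_signs_cube:
  assumes "\<U> \<subseteq> Pow {1..d} - {{}}" "\<U> \<noteq> {}"
  shows "orthogonal_signs (cube d) \<U> (\<lambda>I x. \<Prod>i\<in>I. x i)"
proof
  show "finite \<U>" using assms(1) finite_subset by fastforce
  show "cube d \<noteq> {}" using card_cube[of d] by (metis card.empty power_not_zero zero_neq_numeral)
  show "(\<Prod>i\<in>I. x i) \<in> {-1, 1}" if "I \<in> \<U>" "x \<in> cube d" for I and x :: "nat \<Rightarrow> real"
    using assms(1) that by (intro cube_prod_signs) auto
  show "(\<Sum>x\<in>cube d. \<Prod>i\<in>I. x i) = 0" if "I \<in> \<U>" for I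
    using assms(1) that by (intro sum_cube_prod) auto
  show "(\<Sum>x\<in>cube d. (\<Prod>i\<in>I. x i) * (\<Prod>i\<in>J. x i)) = 0" if "I \<in> \<U>" "J \<in> \<U>" "I \<noteq> J" for I J
  proof -
    have IJ: "I \<subseteq> {1..d}" "J \<subseteq> {1..d}" using assms(1) that by auto
    then have "(\<Sum>x\<in>cube d. (\<Prod>i\<in>I. x i) * (\<Prod>i\<in>J. x i)) =
        (\<Sum>x\<in>cube d. \<Prod>i\<in>(I - J) \<union> (J - I). x i)"
      by (intro sum.cong refl cube_prod_mult)
    also have "\<dots> = 0" using IJ that(3) by (intro sum_cube_prod) auto
    finally show ?thesis .
  qed
qed (use assms finite_cube in auto)

text \<open>Links the law of the samples to \<open>lik\<close>, its density with respect to the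
  uniform measure.\<close>

lemma prod_list_pmf_mu:
  assumes "I \<subseteq> {1..d}" "I \<noteq> {}" "0 < \<rho>" "\<rho> < 1" "xs \<in> words (cube d) t"
  shows "prod_list (map (pmf (mu d I \<rho>)) xs) =
    lik \<rho> (\<lambda>x. \<Prod>i\<in>I. x i) xs / real (card (words (cube d) t))"
proof -
  have "prod_list (map (pmf (mu d I \<rho>)) xs) = lik \<rho> (\<lambda>x. \<Prod>i\<in>I. x i) xs / (2 ^ d) ^ length xs"
    if "set xs \<subseteq> cube d"
    using that by (induction xs) (auto simp: pmf_mu[OF assms(1-4)] mu_density_def)
  then show ?thesis
    using assms(5) by (simp add: words_def card_cube card_words[OF finite_cube, unfolded words_def])
qed

theorem theorem4:
  shows "\<exists>C C' :: real. C > 0 \<and> C' > 0 \<and>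
    (\<forall>(d::nat) (\<U> :: nat set set) (\<rho>::real) (t::nat) (s::nat) (l::nat) (A :: (nat \<Rightarrow> real, (nat \<Rightarrow> real) pmf) mem_alg).
       d \<ge> 2 \<longrightarrow>
       \<U> \<subseteq> Pow {1..d} - {{}} \<longrightarrow>
       real (card \<U>) \<ge> C' \<longrightarrow>
       0 < \<rho> \<longrightarrow> \<rho> < 1 \<longrightarrow>
       \<rho> \<le> real (card \<U>) powr (-3) * ln (real (card \<U>)) powr (-1/2) * inverse C \<longrightarrow>
       t \<ge> 1 \<longrightarrow> s \<ge> 1 \<longrightarrow> l \<ge> 1 \<longrightarrow>
       identifies (mu_family d \<U> \<rho>) t s l (1/3) A \<longrightarrow>
       real (t * s * l) \<ge> real (card \<U>) / (C * \<rho>\<^sup>2 * ln (real (card \<U>))))"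
proof (rule exI[of _ 1000], rule exI[of _ 30], intro conjI allI impI)
  fix d :: nat and \<U> :: "nat set set" and \<rho> :: real and t s l :: nat
    and A :: "(nat \<Rightarrow> real, (nat \<Rightarrow> real) pmf) mem_alg"
  assume \<U>: "\<U> \<subseteq> Pow {1..d} - {{}}" and m: "30 \<le> real (card \<U>)"
    and \<rho>: "0 < \<rho>" "\<rho> < 1"
      "\<rho> \<le> real (card \<U>) powr (-3) * ln (real (card \<U>)) powr (-1/2) * inverse 1000"
    and s: "1 \<le> s" and l: "1 \<le> l" and ident: "identifies (mu_family d \<U> \<rho>) t s l (1/3) A"
  let ?m = "real (card \<U>)"
  interpret orthogonal_signs "cube d" \<U> "\<lambda>I x. \<Prod>i\<in>I. x i"
    using m by (intro orthogonal_signs_cube \<U>) auto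
  have ln_m: "1 \<le> ln ?m"
  proof -
    have "exp 1 \<le> ?m" using exp_le m by linarith
    then show ?thesis using m by (simp add: ln_ge_iff)
  qed
  \<comment> \<open>Since \<open>ln ?m \<ge> 1\<close>, its negative power is at most 1, which
    leaves the bound required by \<open>identification_lower_bound\<close>.\<close>
  have "?m ^ 3 * \<rho> \<le> ?m ^ 3 * (?m powr (-3) * ln ?m powr (-1/2) * inverse 1000)"
    using \<rho>(3) by (intro mult_left_mono) auto
  also have "\<dots> = ln ?m powr (-1/2) / 1000"
    using m by (simp add: powr_minus powr_numeral field_simps)
  also have "\<dots> \<le> 1 / 1000"
    using ln_m powr_mono[of "-1/2" 0 "ln ?m"] by simp
  finally have \<rho>3: "?m ^ 3 * \<rho> \<le> 1 / 1000" .
  have "?m / (1000 * \<rho>\<^sup>2) \<le> real (t * s * l)"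
  proof (rule identification_lower_bound[where A = A and f = "\<lambda>I. mu d I \<rho>"])
    show "is_mem_alg t s l A" using ident by (simp add: identifies_def)
    show "inj_on (\<lambda>I. mu d I \<rho>) \<U>" using inj_on_mu[OF \<rho>(1,2)] \<U> by (rule inj_on_subset)
    fix I assume I: "I \<in> \<U>"
    then have I': "I \<subseteq> {1..d}" "I \<noteq> {}" using \<U> by auto
    let ?S = "{xs \<in> words (cube d) t. alg_output l A xs = mu d I \<rho>}"
    let ?N = "real (card (words (cube d) t))"
    have N: "0 < ?N"
      using finite_words[OF finite_X] words_nonempty[OF X_nonempty] by (simp add: card_gt_0_iff)
    have "set_pmf (mu d I \<rho>) \<subseteq> cube d"
      by (auto simp: set_pmf_iff pmf_mu[OF I' \<rho>(1,2)] mu_density_def split: if_splits)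
    then have "measure_pmf.prob (replicate_pmf t (mu d I \<rho>)) {xs. alg_output l A xs = mu d I \<rho>} =
        (\<Sum>xs\<in>?S. prod_list (map (pmf (mu d I \<rho>)) xs))"
      by (simp add: prob_replicate_pmf[OF finite_cube])
    also have "\<dots> = (\<Sum>xs\<in>?S. lik \<rho> (\<lambda>x. \<Prod>i\<in>I. x i) xs) / ?N"
      unfolding sum_divide_distrib using I' \<rho> by (intro sum.cong refl prod_list_pmf_mu) auto
    finally have "measure_pmf.prob (replicate_pmf t (mu d I \<rho>)) {xs. alg_output l A xs = mu d I \<rho>} =
        (\<Sum>xs\<in>?S. lik \<rho> (\<lambda>x. \<Prod>i\<in>I. x i) xs) / ?N" .
    moreover have "1 - 1 / 3 \<le>
        measure_pmf.prob (replicate_pmf t (mu d I \<rho>)) {xs. alg_output l A xs = mu d I \<rho>}"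
      using ident I unfolding identifies_def mu_family_def by blast
    ultimately have "2 / 3 \<le> (\<Sum>xs\<in>?S. lik \<rho> (\<lambda>x. \<Prod>i\<in>I. x i) xs) / ?N" by simp
    then show "2 / 3 * ?N \<le> (\<Sum>xs\<in>?S. lik \<rho> (\<lambda>x. \<Prod>i\<in>I. x i) xs)"
      using N by (simp add: le_divide_eq)
  qed (use m \<rho> \<rho>3 s l in auto)
  \<comment> \<open>Dividing by \<open>ln ?m \<ge> 1\<close> only weakens the lower bound.\<close>
  moreover have "?m / (1000 * \<rho>\<^sup>2 * ln ?m) \<le> ?m / (1000 * \<rho>\<^sup>2)"
    using ln_m \<rho>(1) by (intro divide_left_mono) (auto simp: mult_le_cancel_left1)
  ultimately show "?m / (1000 * \<rho>\<^sup>2 * ln ?m) \<le> real (t * s * l)" by linarith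
qed auto

end
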